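(* Let $p_0^{\mathrm{b}}$ be a probability density on $\mathbb{R}^d$, let $\lambda>0$, and let $r:\mathbb{R}^d\to(0,\infty)$ have at most linear growth, i.e. there is $C>0$ with $|r(x)|\le C(1+\|x\|)$ for all $x\in\mathbb{R}^d$, and be such that $\int \exp(\lambda r(x))\,p_0^{\mathrm{b}}(x)\,\mathrm{d}x<\infty$. Let $q_{t|0}(x_t\mid x_0)=\mathrm{N}(x_t;\alpha_t x_0,\sigma_t^2\mathrm{I}_d)$ be the Gaussian forward kernel. For $N\in\mathbb{N}^*$ and $k=0,\dots,N$ let $$p_0^{k}(x)=Z_k^{-1}\exp\!\left(\tfrac{k}{N}\lambda r(x)\right)p_0^{\mathrm{b}}(x),$$ where $Z_k$ is the normalising constant, and let $p_t^k(x_t)=\int q_{t|0}(x_t\mid x_0)\,p_0^k(x_0)\,\mathrm{d}x_0$. For all $x_t\in\mathbb{R}^d$ and $t\in(0,1]$, and for $k\in\{1,\dots,N\}$, define the posterior $\pi_{k-1}(\cdot):=p_{0|t}^{k-1}(\cdot\mid x_t)$ and the covariance $$C_{k-1}(x_t,t):=\mathrm{Cov}_{X_0\sim\pi_{k-1}}\!\left(\nabla_{x_t}\log q_{t|0}(x_t\mid X_0),\,r(X_0)\right).$$ Then, for large $N$, $$\nabla_{x_t}\log p_t^{k}(x_t)=\nabla_{x_t}\log p_t^{k-1}(x_t)+\frac{\lambda}{N}\,C_{k-1}(x_t,t)+O\!\left(\frac{1}{N^2}\right).$$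
   Context: The schedules $(\alpha_t)_{t\in[0,1]}$ and $(\sigma_t)_{t\in[0,1]}$ are deterministic real functions with $\alpha_t$ non-increasing, $\sigma_t$ non-decreasing, $(\alpha_0,\sigma_0)=(1,0)$, $(\alpha_1,\sigma_1)=(0,1)$, and $\sigma_t>0$ for $t\in(0,1]$. $\mathrm{N}(x;m,S)$ denotes the density at $x$ of the Gaussian with mean $m$ and covariance $S$. The gradient of the log-kernel in its first argument is $\nabla_{x_t}\log q_{t|0}(x_t\mid x_0)=(\alpha_t x_0-x_t)/\sigma_t^2$. For a density $p_0^{\circ}$ on $\mathbb{R}^d$, the posterior density of the clean sample $X_0$ given its noised version $X_t=x_t$ is $p_{0|t}^{\circ}(x_0\mid x_t)\propto p_0^{\circ}(x_0)\,q_{t|0}(x_t\mid x_0)$, normalised in $x_0$; the notation $p_{0|t}^{k-1}$ is the case $p_0^{\circ}=p_0^{k-1}$. For an $\mathbb{R}^d$-valued function $g$ and a real-valued function $r$, $\mathrm{Cov}_{X_0\sim\pi}(g(X_0),r(X_0))=\mathbb{E}_\pi[g(X_0)r(X_0)]-\mathbb{E}_\pi[g(X_0)]\,\mathbb{E}_\pi[r(X_0)]\in\mathbb{R}^d$. *)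

theory Defs
  imports "HOL-Analysis.Analysis"
begin

definition prob_density :: "('a::euclidean_space \<Rightarrow> real) \<Rightarrow> bool" where
  "prob_density p \<longleftrightarrow> (\<forall>x. 0 \<le> p x) \<and> has_bochner_integral lborel p 1"

text \<open>Unspecified where \<open>f\<close> is not differentiable.\<close>

definition gradient :: "('a::real_inner \<Rightarrow> real) \<Rightarrow> 'a \<Rightarrow> 'a" where
  "gradient f x = (THE D. GDERIV f x :> D)"

text \<open>Density at \<open>x\<close> of the Gaussian with mean \<open>m\<close> and covariance matrix \<open>S\<close>;
  meaningful for symmetric positive definite \<open>S\<close>.\<close>

definition gaussian_density :: "real ^ 'n \<Rightarrow> real ^ 'n ^ 'n \<Rightarrow> real ^ 'n \<Rightarrow> real" where
  "gaussian_density m S x =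
     exp (- (1 / 2) * ((x - m) \<bullet> (matrix_inv S *v (x - m)))) / sqrt (det ((2 * pi) *\<^sub>R S))"

definition forward_kernel ::
    "(real \<Rightarrow> real) \<Rightarrow> (real \<Rightarrow> real) \<Rightarrow> real \<Rightarrow> real ^ 'n \<Rightarrow> real ^ 'n \<Rightarrow> real" where
  "forward_kernel \<alpha> \<sigma> t xt x0 = gaussian_density (\<alpha> t *\<^sub>R x0) ((\<sigma> t)\<^sup>2 *\<^sub>R mat 1) xt"

definition noised_density ::
    "(real \<Rightarrow> real) \<Rightarrow> (real \<Rightarrow> real) \<Rightarrow> real \<Rightarrow> (real ^ 'n \<Rightarrow> real) \<Rightarrow> real ^ 'n \<Rightarrow> real" where
  "noised_density \<alpha> \<sigma> t p xt = (LINT x0|lborel. forward_kernel \<alpha> \<sigma> t xt x0 * p x0)"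

definition posterior_density ::
    "(real \<Rightarrow> real) \<Rightarrow> (real \<Rightarrow> real) \<Rightarrow> real \<Rightarrow> (real ^ 'n \<Rightarrow> real) \<Rightarrow> real ^ 'n \<Rightarrow> real ^ 'n \<Rightarrow> real" where
  "posterior_density \<alpha> \<sigma> t p xt x0 =
     p x0 * forward_kernel \<alpha> \<sigma> t xt x0 / (LINT y|lborel. p y * forward_kernel \<alpha> \<sigma> t xt y)"

definition tilted_density ::
    "(real ^ 'n \<Rightarrow> real) \<Rightarrow> real \<Rightarrow> (real ^ 'n \<Rightarrow> real) \<Rightarrow> nat \<Rightarrow> nat \<Rightarrow> real ^ 'n \<Rightarrow> real" where
  "tilted_density pb lam r N k x =
     exp (real k / real N * lam * r x) * pb x /
       (LINT y|lborel. exp (real k / real N * lam * r y) * pb y)"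

text \<open>The covariance of the vector \<open>g(X)\<close> with the scalar \<open>s(X)\<close>, for \<open>X\<close>
  with Lebesgue density \<open>p\<close>.\<close>

definition cov_under ::
    "(real ^ 'n \<Rightarrow> real) \<Rightarrow> (real ^ 'n \<Rightarrow> real ^ 'n) \<Rightarrow> (real ^ 'n \<Rightarrow> real) \<Rightarrow> real ^ 'n" where
  "cov_under p g s =
     (let M = density lborel (\<lambda>x. ennreal (p x))
      in (LINT x|M. s x *\<^sub>R g x) - (LINT x|M. s x) *\<^sub>R (LINT x|M. g x))"

definition score ::
    "(real \<Rightarrow> real) \<Rightarrow> (real \<Rightarrow> real) \<Rightarrow> real \<Rightarrow> (real ^ 'n \<Rightarrow> real) \<Rightarrow> real ^ 'n \<Rightarrow> real ^ 'n" where
  "score \<alpha> \<sigma> t p xt = gradient (\<lambda>x. ln (noised_density \<alpha> \<sigma> t p x)) xt"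

definition score_cov ::
    "(real \<Rightarrow> real) \<Rightarrow> (real \<Rightarrow> real) \<Rightarrow> real \<Rightarrow> (real ^ 'n \<Rightarrow> real) \<Rightarrow> (real ^ 'n \<Rightarrow> real) \<Rightarrow>
       real ^ 'n \<Rightarrow> real ^ 'n" where
  "score_cov \<alpha> \<sigma> t p r xt =
     cov_under (posterior_density \<alpha> \<sigma> t p xt)
       (\<lambda>x0. gradient (\<lambda>x. ln (forward_kernel \<alpha> \<sigma> t x x0)) xt) r"

end

(* With unnormalised weights w_theta(y) = exp (theta r(y)) pb(y), the score of the noised tilted
   density is the posterior mean A(theta) / B(theta) of the kernel score (alpha y - x) / sigma^2, where
   A and B are Laplace-type integrals in theta; the normalising constant cancels.  Its theta-derivative
   is the posterior covariance with r, so the claim is a second-order expansion in a step lam / N that is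
   uniform in theta.  If alpha is nonzero, the Gaussian kernel dominates all moments of r and of the kernel score
   against exp (lam r), because r grows at most linearly.  If alpha = 0, those moments need not exist, but
   the kernel score is constant in y, so all scores agree and the covariance vanishes. *)

theory Submission
  imports Defs
begin

text \<open>Uniformity in \<theta> comes from \<open>r \<ge> 0\<close>: on the whole parameter
  interval \<open>exp (\<theta> * r x)\<close> lies between 1 and \<open>exp (l * r x)\<close>. The
  lower bound keeps every denominator away from 0, and one majorant with the factor
  \<open>(1 + r x)\<^sup>2\<close> controls the mass, the first moment of \<open>r\<close> and the
  second-order remainder at once. The delicate point is the right end of the interval. The last step
  lands on \<theta> + h = l, where only \<open>exp (l * r x) * p x\<close> is known to be
  integrable; the additional powers of \<open>r\<close> must come from the decay of the kernel.
  Without decay, a base point \<theta> < l still leaves a gap that pays for a first moment of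
  \<open>r\<close>. The resulting bound blows up as the gap closes, which is harmless because the
  remainder is then exactly 0. The score of the noised density is obtained without dominated
  convergence: the second derivative of the Gaussian kernel in the noised variable is bounded
  uniformly in the clean sample, so a quadratic Taylor bound can be integrated against any
  integrable \<open>p\<close>.\<close>

section \<open>Exponential inequalities and a uniform Taylor bound for the Gaussian\<close>

lemma exp_remainder_bounds:
  fixes x :: real
  assumes "0 \<le> x"
  shows "0 \<le> exp x - 1 - x" and "exp x - 1 - x \<le> x\<^sup>2 * exp x"
proof -
  show "0 \<le> exp x - 1 - x"
    using exp_ge_add_one_self[of x] by linarith
  have "(1 - x) * exp x \<le> exp (- x) * exp x"
    using exp_ge_add_one_self[of "- x"] by (intro mult_right_mono) auto
  then have *: "exp x - 1 \<le> x * exp x"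
    by (simp add: exp_minus algebra_simps)
  \<comment> \<open>The inequality \<open>exp x - 1 \<le> x * exp x\<close> is used twice; this
    gives up the factor 1/2 of Taylor's formula.\<close>
  have "exp x - 1 - x \<le> x * (exp x - 1)"
    using * by (simp add: algebra_simps)
  also have "\<dots> \<le> x * (x * exp x)"
    using * assms by (intro mult_left_mono)
  finally show "exp x - 1 - x \<le> x\<^sup>2 * exp x"
    by (simp add: power2_eq_square)
qed

lemma mult_exp_minus_le_one: "x * exp (- x) \<le> (1::real)"
proof -
  have "x \<le> exp x"
    using exp_ge_add_one_self[of x] by linarith
  then show ?thesis
    by (simp add: exp_minus field_simps)
qed

text \<open>Along the segment from \<open>u\<close> to \<open>u + h\<close> the second derivative is
  at most 2 |h|^2 / s^2 in absolute value, wherever \<open>u\<close> lies, because the quadratic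
  factor it contains is beaten by the exponential. Independence of \<open>u\<close> later becomes
  independence of the clean sample.\<close>

lemma gauss_taylor:
  fixes u h :: "'a::real_inner" and s :: real
  assumes "0 < s"
  shows "\<bar>exp (- (norm (u + h))\<^sup>2 / (2 * s\<^sup>2)) - exp (- (norm u)\<^sup>2 / (2 * s\<^sup>2))
           + exp (- (norm u)\<^sup>2 / (2 * s\<^sup>2)) * (h \<bullet> u) / s\<^sup>2\<bar> \<le> (norm h)\<^sup>2 / s\<^sup>2"
proof -
  define P where "P \<tau> = u \<bullet> u + 2 * \<tau> * (u \<bullet> h) + \<tau>\<^sup>2 * (h \<bullet> h)" for \<tau>
  have P: "(norm (u + \<tau> *\<^sub>R h))\<^sup>2 = P \<tau>" for \<tau>
    unfolding power2_norm_eq_inner P_def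
    by (simp add: inner_add_left inner_add_right inner_commute power2_eq_square algebra_simps)
  define \<phi> where "\<phi> \<tau> = exp (- P \<tau> / (2 * s\<^sup>2))" for \<tau>
  \<comment> \<open>\<open>L\<close> is the derivative of \<open>P\<close> divided by 2 s^2, and
    \<open>D m\<close> is the m-th derivative of \<phi> for m \<le> 2, indexed as
    \<open>Maclaurin\<close> requires.\<close>
  define L where "L \<tau> = (u \<bullet> h + \<tau> * (h \<bullet> h)) / s\<^sup>2" for \<tau>
  define D where "D m = (if m = 0 then \<phi> else if m = 1 then (\<lambda>\<tau>. - \<phi> \<tau> * L \<tau>)
      else (\<lambda>\<tau>. \<phi> \<tau> * ((L \<tau>)\<^sup>2 - (h \<bullet> h) / s\<^sup>2)))" for m :: nat
  have d\<phi>: "DERIV \<phi> \<tau> :> - \<phi> \<tau> * L \<tau>" for \<tau>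
    unfolding \<phi>_def P_def L_def using assms
    by (auto intro!: derivative_eq_intros simp: field_simps)
  have dL: "DERIV L \<tau> :> (h \<bullet> h) / s\<^sup>2" for \<tau>
    unfolding L_def using assms
    by (auto intro!: derivative_eq_intros simp: power2_eq_square power4_eq_xxxx)
  have "\<forall>m t. m < 2 \<and> 0 \<le> t \<and> t \<le> 1 \<longrightarrow> DERIV (D m) t :> D (Suc m) t"
  proof (intro allI impI)
    fix m :: nat and t :: real
    assume "m < 2 \<and> 0 \<le> t \<and> t \<le> 1"
    then have "m = 0 \<or> m = 1" by auto
    then show "DERIV (D m) t :> D (Suc m) t"
    proof
      assume "m = 0"
      then show ?thesis
        using d\<phi>[of t] by (simp add: D_def)
    next
      assume "m = 1"
      then show ?thesis
        using DERIV_minus[OF DERIV_mult[OF d\<phi> dL], of t]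
        by (simp add: D_def algebra_simps power2_eq_square)
    qed
  qed
  from Maclaurin[OF zero_less_one _ _ this, of \<phi>] obtain t where
    t: "\<phi> 1 = (\<Sum>m<2. D m 0 / fact m * 1 ^ m) + D 2 t / fact 2 * 1 ^ 2"
    by (auto simp: D_def)
  then have "\<phi> 1 - \<phi> 0 + \<phi> 0 * L 0 = D 2 t / 2"
    by (simp add: D_def numeral_2_eq_2)
  moreover have "\<phi> 0 * L 0 = exp (- (norm u)\<^sup>2 / (2 * s\<^sup>2)) * (h \<bullet> u) / s\<^sup>2"
    unfolding \<phi>_def L_def P[symmetric] by (simp add: inner_commute)
  moreover have "\<phi> 1 = exp (- (norm (u + h))\<^sup>2 / (2 * s\<^sup>2))" "\<phi> 0 = exp (- (norm u)\<^sup>2 / (2 * s\<^sup>2))"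
    unfolding \<phi>_def P[symmetric] by simp_all
  ultimately have eq: "exp (- (norm (u + h))\<^sup>2 / (2 * s\<^sup>2)) - exp (- (norm u)\<^sup>2 / (2 * s\<^sup>2))
           + exp (- (norm u)\<^sup>2 / (2 * s\<^sup>2)) * (h \<bullet> u) / s\<^sup>2 = D 2 t / 2"
    by simp
  have "\<bar>D 2 t\<bar> \<le> 2 * ((h \<bullet> h) / s\<^sup>2)"
  proof -
    \<comment> \<open>Cauchy-Schwarz trades \<open>(L t)\<^sup>2\<close> for a multiple of
      \<open>P t\<close>, which produces x exp (-x) with x =
      \<open>P t / (2 * s\<^sup>2)\<close>.\<close>
    define v where "v = u + t *\<^sub>R h"
    have "(v \<bullet> h)\<^sup>2 \<le> (v \<bullet> v) * (h \<bullet> h)"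
      by (rule Cauchy_Schwarz_ineq)
    moreover have "L t = (v \<bullet> h) / s\<^sup>2"
      by (simp add: L_def v_def inner_add_left)
    moreover have "v \<bullet> v = P t"
      using P[of t] by (simp add: v_def power2_norm_eq_inner)
    ultimately have "\<phi> t * (L t)\<^sup>2 \<le> \<phi> t * ((P t * (h \<bullet> h)) / (s\<^sup>2)\<^sup>2)"
      by (intro mult_left_mono) (auto simp: power_divide \<phi>_def intro!: divide_right_mono)
    also have "\<dots> = 2 * ((h \<bullet> h) / s\<^sup>2) * (P t / (2 * s\<^sup>2) * exp (- (P t / (2 * s\<^sup>2))))"
      using assms by (simp add: \<phi>_def field_simps power2_eq_square)
    also have "\<dots> \<le> 2 * ((h \<bullet> h) / s\<^sup>2) * 1"
      by (intro mult_left_mono mult_exp_minus_le_one) auto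
    finally have 1: "\<phi> t * (L t)\<^sup>2 \<le> 2 * ((h \<bullet> h) / s\<^sup>2)" by simp
    have "0 \<le> P t" using P[of t] by (metis zero_le_power2)
    then have "\<phi> t \<le> 1" by (simp add: \<phi>_def)
    then have 2: "\<phi> t * ((h \<bullet> h) / s\<^sup>2) \<le> 1 * ((h \<bullet> h) / s\<^sup>2)"
      by (intro mult_right_mono) auto
    have "0 \<le> (h \<bullet> h) / s\<^sup>2" "0 \<le> \<phi> t" by (auto simp: \<phi>_def)
    then have 3: "0 \<le> \<phi> t * (L t)\<^sup>2" "0 \<le> \<phi> t * ((h \<bullet> h) / s\<^sup>2)" "0 \<le> (h \<bullet> h) / s\<^sup>2"
      by (simp_all only: mult_nonneg_nonneg zero_le_power2)
    \<comment> \<open>\<open>D 2 t\<close> is a difference of two nonnegative terms with the same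
      upper bound, so its absolute value obeys that bound without doubling.\<close>
    show ?thesis
      unfolding D_def using 1 2 3 by (auto simp: right_diff_distrib abs_le_iff)
  qed
  then show ?thesis
    unfolding eq by (simp add: power2_norm_eq_inner mult.commute)
qed

section \<open>Gradients from quadratic remainders\<close>

lemma GDERIV_of_quadratic_remainder:
  fixes f :: "'a::real_inner \<Rightarrow> real"
  assumes "\<And>h. \<bar>f (x + h) - f x - h \<bullet> D\<bar> \<le> K * (norm h)\<^sup>2"
  shows "GDERIV f x :> D"
  unfolding gderiv_def has_derivative_at
proof (intro conjI)
  show "bounded_linear (\<lambda>h. h \<bullet> D)"
    by (rule bounded_linear_inner_left)
  have "(\<lambda>h. norm (f (x + h) - f x - h \<bullet> D) / norm h) \<midarrow>0\<rightarrow> 0"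
  proof (rule Lim_null_comparison)
    show "\<forall>\<^sub>F h in at 0. norm (norm (f (x + h) - f x - h \<bullet> D) / norm h) \<le> K * norm h"
    proof (rule always_eventually, intro allI)
      fix h
      show "norm (norm (f (x + h) - f x - h \<bullet> D) / norm h) \<le> K * norm h"
        using assms[of h] by (cases "h = 0") (auto simp: divide_le_eq power2_eq_square mult_ac)
    qed
    show "(\<lambda>h. K * norm h) \<midarrow>0\<rightarrow> 0"
      by (auto intro!: tendsto_eq_intros)
  qed
  then show "(\<lambda>h. norm (f (x + h) - f x - h \<bullet> D) / norm h) \<midarrow>0\<rightarrow> 0" .
qed

lemma gradient_eqI:
  assumes "GDERIV f x :> D"
  shows "gradient f x = D"
  unfolding gradient_def
proof (rule the_equality)
  show "GDERIV f x :> D" by (rule assms)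
next
  fix E assume "GDERIV f x :> E"
  with assms have "(\<lambda>h. h \<bullet> E) = (\<lambda>h. h \<bullet> D)"
    unfolding gderiv_def by (rule has_derivative_unique[rotated])
  then show "E = D"
    by (metis vector_eq_ldot inner_commute)
qed

section \<open>Second-order expansion of a quotient\<close>

lemma norm_divideR_le:
  fixes A :: "'b::real_normed_vector"
  assumes "0 < b" "b \<le> B" "norm A \<le> m"
  shows "norm (A /\<^sub>R B) \<le> m / b"
proof -
  have "norm (A /\<^sub>R B) = norm A / B"
    using assms by (simp add: divide_inverse)
  also have "\<dots> \<le> m / b"
    using assms by (intro frac_le) (auto intro: order_trans[OF norm_ge_zero])
  finally show ?thesis .
qed

text \<open>The first-order term is the quotient rule, (A1 - B1 S) / B with S = A / B. The constant
  is explicit so that it visibly depends on \<open>b\<close>, \<open>l\<close> and \<open>m\<close>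
  alone; this is what later makes it uniform in the tilt.\<close>

lemma quotient_expansion:
  fixes A A1 A' :: "'b::real_normed_vector" and B B1 B' b h l m :: real
  assumes "0 < b" "b \<le> B" "b \<le> B'" "0 \<le> h" "h \<le> l"
    and "norm A \<le> m" "norm A1 \<le> m" "\<bar>B1\<bar> \<le> m"
    and "norm (A' - A - h *\<^sub>R A1) \<le> h\<^sup>2 * m" "\<bar>B' - B - h * B1\<bar> \<le> h\<^sup>2 * m"
  shows "norm (A' /\<^sub>R B' - (A /\<^sub>R B + h *\<^sub>R (A1 /\<^sub>R B - (B1 / B) *\<^sub>R (A /\<^sub>R B))))
      \<le> (m + m * (m / b) + (m + l * m) * (m / b + m / b * (m / b))) / b * h\<^sup>2"
proof -
  define S where "S = A /\<^sub>R B"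
  define T where "T = A1 /\<^sub>R B - (B1 / B) *\<^sub>R S"
  define R where "R = A' - A - h *\<^sub>R A1"
  define Q where "Q = B' - B - h * B1"
  have pos: "0 < B" "0 < B'" "0 \<le> m"
    using assms by (auto intro: order_trans[OF norm_ge_zero])
  have "B *\<^sub>R S = A" "B *\<^sub>R T = A1 - B1 *\<^sub>R S"
    using pos by (simp_all add: S_def T_def scaleR_diff_right)
  moreover have "A' = A + h *\<^sub>R A1 + R" "B' = B + h * B1 + Q"
    by (simp_all add: R_def Q_def)
  \<comment> \<open>After multiplication by \<open>B'\<close> the terms of order 0 and 1 in
    \<open>h\<close> cancel, since B S = A and B T = A1 - B1 S. What survives are the two remainders
    and \<open>h\<close> times the increment B' - B, which equals \<open>h * B1 + Q\<close>.\<close>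
  ultimately have eq: "A' - B' *\<^sub>R S - (h * B') *\<^sub>R T = R - Q *\<^sub>R S - (h * (h * B1 + Q)) *\<^sub>R T"
  proof -
    have "(h * B') *\<^sub>R T = h *\<^sub>R (A1 - B1 *\<^sub>R S) + (h * (h * B1 + Q)) *\<^sub>R T"
      using \<open>B' = B + h * B1 + Q\<close>
      unfolding \<open>B *\<^sub>R T = _\<close>[symmetric] by (simp add: algebra_simps)
    moreover have "B' *\<^sub>R S = A + (h * B1) *\<^sub>R S + Q *\<^sub>R S"
      using \<open>B' = B + h * B1 + Q\<close> \<open>B *\<^sub>R S = A\<close> by (simp add: scaleR_left_distrib)
    ultimately show ?thesis
      using \<open>A' = _\<close> by (simp add: algebra_simps)
  qed
  have "A' /\<^sub>R B' - (S + h *\<^sub>R T) = (A' - B' *\<^sub>R S - (h * B') *\<^sub>R T) /\<^sub>R B'"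
    using pos by (simp add: scaleR_diff_right)
  moreover have "norm (R - Q *\<^sub>R S - (h * (h * B1 + Q)) *\<^sub>R T)
      \<le> (m + m * (m / b) + (m + l * m) * (m / b + m / b * (m / b))) * h\<^sup>2"
  proof -
    have S: "norm S \<le> m / b"
      unfolding S_def using assms by (intro norm_divideR_le)
    have "norm T \<le> norm (A1 /\<^sub>R B) + norm ((B1 / B) *\<^sub>R S)"
      unfolding T_def by (rule norm_triangle_ineq4)
    also have "norm (A1 /\<^sub>R B) \<le> m / b"
      using assms by (intro norm_divideR_le)
    also have "norm ((B1 / B) *\<^sub>R S) \<le> m / b * (m / b)"
      unfolding norm_scaleR using assms pos S
      by (intro mult_mono) (auto simp: frac_le)
    finally have T: "norm T \<le> m / b + m / b * (m / b)" by simp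
    \<comment> \<open>The increment contributes h^2 m + h^3 m; lowering the cubic term to order two
      is the source of \<open>l\<close> in the constant.\<close>
    have "h * h\<^sup>2 \<le> l * h\<^sup>2"
      using assms by (intro mult_right_mono) auto
    then have "h * h\<^sup>2 * m \<le> l * h\<^sup>2 * m"
      using pos(3) by (rule mult_right_mono)
    moreover have "h * \<bar>h * B1 + Q\<bar> \<le> h * (h * m + h\<^sup>2 * m)"
    proof (intro mult_left_mono)
      have "\<bar>h * B1\<bar> \<le> h * m"
        using assms by (simp add: abs_mult mult_left_mono)
      then show "\<bar>h * B1 + Q\<bar> \<le> h * m + h\<^sup>2 * m"
        using assms by (simp add: Q_def)
    qed (use assms in auto)
    moreover have "\<bar>h * (h * B1 + Q)\<bar> = h * \<bar>h * B1 + Q\<bar>"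
      using assms(4) by (simp add: abs_mult)
    ultimately have "\<bar>h * (h * B1 + Q)\<bar> \<le> (m + l * m) * h\<^sup>2"
      by (simp add: distrib_left distrib_right power2_eq_square mult_ac)
    then have "norm ((h * (h * B1 + Q)) *\<^sub>R T) \<le> (m + l * m) * h\<^sup>2 * (m / b + m / b * (m / b))"
      unfolding norm_scaleR using T by (intro mult_mono) auto
    moreover have "norm (Q *\<^sub>R S) \<le> h\<^sup>2 * m * (m / b)"
      unfolding norm_scaleR using S assms by (intro mult_mono) (auto simp: Q_def)
    moreover have "norm R \<le> h\<^sup>2 * m"
      using assms by (simp add: R_def)
    moreover have "norm (R - Q *\<^sub>R S - (h * (h * B1 + Q)) *\<^sub>R T)
        \<le> norm R + norm (Q *\<^sub>R S) + norm ((h * (h * B1 + Q)) *\<^sub>R T)"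
      using norm_triangle_ineq4[of "R - Q *\<^sub>R S" "(h * (h * B1 + Q)) *\<^sub>R T"]
        norm_triangle_ineq4[of R "Q *\<^sub>R S"] by linarith
    \<comment> \<open>A variable \<open>w\<close> stands for \<open>m / b\<close>, so the identity
      is polynomial.\<close>
    moreover have ring: "(m + m * w + (m + l * m) * (w + w * w)) * h\<^sup>2
        = h\<^sup>2 * m + h\<^sup>2 * m * w + (m + l * m) * h\<^sup>2 * (w + w * w)" for w
      by (simp add: algebra_simps)
    ultimately show ?thesis
      unfolding ring by linarith
  qed
  ultimately have "norm (A' /\<^sub>R B' - (S + h *\<^sub>R T))
      \<le> ((m + m * (m / b) + (m + l * m) * (m / b + m / b * (m / b))) * h\<^sup>2) / b"
    using assms unfolding eq by (metis norm_divideR_le)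
  then show ?thesis
    by (simp add: S_def T_def)
qed

section \<open>Exponentially tilted integrals and means\<close>

text \<open>Both 1 and \<open>r x\<close> are at most \<open>(1 + r x)\<^sup>2\<close>, and the
  exponential is monotone in \<theta> as \<open>r\<close> is nonnegative, so a single
  \<open>W\<close> serves every \<theta>. The function \<open>f\<close> stays general because it is
  taken to be the vector integrand for numerators and the constant 1 for denominators.\<close>

lemma exp_tilt_integral_bounds:
  fixes f :: "'a \<Rightarrow> 'b::{banach, second_countable_topology}" and v r W :: "'a \<Rightarrow> real"
  assumes [measurable]: "v \<in> borel_measurable M" "r \<in> borel_measurable M" "f \<in> borel_measurable M"
    and v: "\<And>x. 0 \<le> v x" and r: "\<And>x. 0 \<le> r x"
    and W: "integrable M W" "\<And>x. norm (f x) * (v x * (1 + r x)\<^sup>2 * exp (l * r x)) \<le> W x"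
    and \<theta>: "0 \<le> \<theta>" "\<theta> \<le> l"
  shows "integrable M (\<lambda>x. (exp (\<theta> * r x) * v x) *\<^sub>R f x)"
    and "integrable M (\<lambda>x. (exp (\<theta> * r x) * v x * r x) *\<^sub>R f x)"
    and "norm (LINT x|M. (exp (\<theta> * r x) * v x) *\<^sub>R f x) \<le> integral\<^sup>L M W"
    and "norm (LINT x|M. (exp (\<theta> * r x) * v x * r x) *\<^sub>R f x) \<le> integral\<^sup>L M W"
proof -
  have b: "norm ((exp (\<theta> * r x) * v x * w) *\<^sub>R f x) \<le> W x" if "0 \<le> w" "w \<le> (1 + r x)\<^sup>2" for x w
  proof -
    have "exp (\<theta> * r x) * w \<le> exp (l * r x) * (1 + r x)\<^sup>2"
      using \<theta> r[of x] that by (intro mult_mono) (auto intro: mult_right_mono)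
    from mult_left_mono[OF this, of "norm (f x) * v x"] show ?thesis
      using W(2)[of x] v[of x] that by (simp add: abs_mult mult_ac)
  qed
  have b0: "norm ((exp (\<theta> * r x) * v x) *\<^sub>R f x) \<le> W x" for x
    using b[of 1 x] r[of x] by (simp add: power2_eq_square algebra_simps)
  have b1: "norm ((exp (\<theta> * r x) * v x * r x) *\<^sub>R f x) \<le> W x" for x
    using b[of "r x" x] r[of x] by (simp add: power2_eq_square algebra_simps)
  have W': "norm (W x) = W x" for x
    using order_trans[OF norm_ge_zero b0[of x]] by simp
  show 0: "integrable M (\<lambda>x. (exp (\<theta> * r x) * v x) *\<^sub>R f x)"
    by (rule Bochner_Integration.integrable_bound[OF W(1)]) (auto simp only: W' b0 intro!: AE_I2, measurable)
  show 1: "integrable M (\<lambda>x. (exp (\<theta> * r x) * v x * r x) *\<^sub>R f x)"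
    by (rule Bochner_Integration.integrable_bound[OF W(1)]) (auto simp only: W' b1 intro!: AE_I2, measurable)
  show "norm (LINT x|M. (exp (\<theta> * r x) * v x) *\<^sub>R f x) \<le> integral\<^sup>L M W"
    by (rule order_trans[OF integral_norm_bound integral_mono[OF integrable_norm[OF 0] W(1) b0]])
  show "norm (LINT x|M. (exp (\<theta> * r x) * v x * r x) *\<^sub>R f x) \<le> integral\<^sup>L M W"
    by (rule order_trans[OF integral_norm_bound integral_mono[OF integrable_norm[OF 1] W(1) b1]])
qed

text \<open>The square in the majorant is spent here: the remainder of the exponential is at most
  h^2 r^2 exp ((\<theta> + h) r), and \<theta> + h \<le> l.\<close>

lemma exp_tilt_integral_expansion:
  fixes f :: "'a \<Rightarrow> 'b::{banach, second_countable_topology}" and v r W :: "'a \<Rightarrow> real"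
  assumes [measurable]: "v \<in> borel_measurable M" "r \<in> borel_measurable M" "f \<in> borel_measurable M"
    and v: "\<And>x. 0 \<le> v x" and r: "\<And>x. 0 \<le> r x"
    and W: "integrable M W" "\<And>x. norm (f x) * (v x * (1 + r x)\<^sup>2 * exp (l * r x)) \<le> W x"
    and \<theta>: "0 \<le> \<theta>" "0 \<le> h" "\<theta> + h \<le> l"
  shows "norm ((LINT x|M. (exp ((\<theta> + h) * r x) * v x) *\<^sub>R f x)
      - (LINT x|M. (exp (\<theta> * r x) * v x) *\<^sub>R f x)
      - h *\<^sub>R (LINT x|M. (exp (\<theta> * r x) * v x * r x) *\<^sub>R f x)) \<le> h\<^sup>2 * integral\<^sup>L M W"
proof -
  note int = exp_tilt_integral_bounds(1,2)[OF assms(1-7)]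
  define e where "e x = exp (\<theta> * r x) * (exp (h * r x) - 1 - h * r x)" for x
  have [measurable]: "e \<in> borel_measurable M"
    unfolding e_def by measurable
  have bound: "norm ((e x * v x) *\<^sub>R f x) \<le> h\<^sup>2 * W x" for x
  proof -
    have hr: "0 \<le> h * r x" using \<theta> r by simp
    have "e x \<le> exp (\<theta> * r x) * ((h * r x)\<^sup>2 * exp (h * r x))"
      unfolding e_def using exp_remainder_bounds(2)[OF hr] by simp
    also have "\<dots> = h\<^sup>2 * ((r x)\<^sup>2 * exp ((\<theta> + h) * r x))"
      by (simp add: exp_add algebra_simps power_mult_distrib)
    also have "\<dots> \<le> h\<^sup>2 * ((1 + r x)\<^sup>2 * exp (l * r x))"
      using \<theta> r[of x] by (intro mult_left_mono mult_mono) (auto intro: power_mono mult_right_mono)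
    finally have "e x \<le> h\<^sup>2 * ((1 + r x)\<^sup>2 * exp (l * r x))" .
    moreover have "0 \<le> e x"
      unfolding e_def using exp_remainder_bounds(1)[OF hr] by simp
    ultimately have "norm ((e x * v x) *\<^sub>R f x) \<le> (h\<^sup>2 * ((1 + r x)\<^sup>2 * exp (l * r x)) * v x) * norm (f x)"
      unfolding norm_scaleR using v[of x] by (intro mult_right_mono) (auto simp: abs_mult mult_right_mono)
    also have "\<dots> = h\<^sup>2 * (norm (f x) * (v x * (1 + r x)\<^sup>2 * exp (l * r x)))"
      by (simp add: mult_ac)
    also have "\<dots> \<le> h\<^sup>2 * W x"
      using W(2) by (intro mult_left_mono) auto
    finally show ?thesis .
  qed
  have "(LINT x|M. (exp ((\<theta> + h) * r x) * v x) *\<^sub>R f x)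
      - (LINT x|M. (exp (\<theta> * r x) * v x) *\<^sub>R f x)
      - h *\<^sub>R (LINT x|M. (exp (\<theta> * r x) * v x * r x) *\<^sub>R f x)
     = (LINT x|M. (exp ((\<theta> + h) * r x) * v x) *\<^sub>R f x - (exp (\<theta> * r x) * v x) *\<^sub>R f x
      - h *\<^sub>R ((exp (\<theta> * r x) * v x * r x) *\<^sub>R f x))"
    using int[of \<theta>] int[of "\<theta> + h"] \<theta>
    by (simp del: scaleR_scaleR)
  also have "\<dots> = (LINT x|M. (e x * v x) *\<^sub>R f x)"
    by (rule Bochner_Integration.integral_cong)
      (auto simp: e_def exp_add algebra_simps simp flip: scaleR_diff_left)
  finally have eq: "(LINT x|M. (exp ((\<theta> + h) * r x) * v x) *\<^sub>R f x)
      - (LINT x|M. (exp (\<theta> * r x) * v x) *\<^sub>R f x)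
      - h *\<^sub>R (LINT x|M. (exp (\<theta> * r x) * v x * r x) *\<^sub>R f x) = (LINT x|M. (e x * v x) *\<^sub>R f x)" .
  have "integrable M (\<lambda>x. (e x * v x) *\<^sub>R f x)"
  proof (rule Bochner_Integration.integrable_bound)
    show "integrable M (\<lambda>x. h\<^sup>2 * W x)" using W(1) by simp
    show "AE x in M. norm ((e x * v x) *\<^sub>R f x) \<le> norm (h\<^sup>2 * W x)"
      using bound by (intro AE_I2) (metis abs_ge_self order_trans real_norm_def)
  qed measurable
  then have "norm (LINT x|M. (e x * v x) *\<^sub>R f x) \<le> (LINT x|M. h\<^sup>2 * W x)"
    using W(1) bound
    by (intro order_trans[OF integral_norm_bound integral_mono[OF integrable_norm]]) simp_all
  then show ?thesis
    unfolding eq by simp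
qed

text \<open>\<open>A \<theta> /\<^sub>R B \<theta>\<close> is the mean of \<open>g\<close> under the
  normalised tilted weight, and the factor of \<open>h\<close> is the covariance of \<open>g\<close>
  with \<open>r\<close> under the same weight. \<open>K\<close> is fixed before \<theta> and
  \<open>h\<close>.\<close>

lemma exp_tilt_mean_expansion:
  fixes g :: "'a \<Rightarrow> 'b::{banach, second_countable_topology}" and v r :: "'a \<Rightarrow> real"
  assumes [measurable]: "v \<in> borel_measurable M" "r \<in> borel_measurable M" "g \<in> borel_measurable M"
    and v: "\<And>x. 0 \<le> v x" and r: "\<And>x. 0 \<le> r x"
    and W: "integrable M (\<lambda>x. (1 + norm (g x)) * (v x * (1 + r x)\<^sup>2 * exp (l * r x)))"
    and l: "0 \<le> l" and b: "0 < integral\<^sup>L M v"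
  defines "A \<equiv> \<lambda>\<theta>. LINT x|M. (exp (\<theta> * r x) * v x) *\<^sub>R g x"
    and "A1 \<equiv> \<lambda>\<theta>. LINT x|M. (exp (\<theta> * r x) * v x * r x) *\<^sub>R g x"
    and "B \<equiv> \<lambda>\<theta>. LINT x|M. exp (\<theta> * r x) * v x"
    and "B1 \<equiv> \<lambda>\<theta>. LINT x|M. exp (\<theta> * r x) * v x * r x"
  obtains K where "\<And>\<theta> h. 0 \<le> \<theta> \<Longrightarrow> 0 \<le> h \<Longrightarrow> \<theta> + h \<le> l \<Longrightarrow>
     norm (A (\<theta> + h) /\<^sub>R B (\<theta> + h)
       - (A \<theta> /\<^sub>R B \<theta> + h *\<^sub>R (A1 \<theta> /\<^sub>R B \<theta> - (B1 \<theta> / B \<theta>) *\<^sub>R (A \<theta> /\<^sub>R B \<theta>)))) \<le> K * h\<^sup>2"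
proof -
  let ?W = "\<lambda>x. (1 + norm (g x)) * (v x * (1 + r x)\<^sup>2 * exp (l * r x))"
  define m where "m = integral\<^sup>L M ?W"
  have A: "A \<theta> = (LINT x|M. (exp (\<theta> * r x) * v x) *\<^sub>R g x)"
    and A1: "A1 \<theta> = (LINT x|M. (exp (\<theta> * r x) * v x * r x) *\<^sub>R g x)"
    and B: "B \<theta> = (LINT x|M. exp (\<theta> * r x) * v x)"
    and B1: "B1 \<theta> = (LINT x|M. exp (\<theta> * r x) * v x * r x)" for \<theta>
    by (simp_all add: A_def A1_def B_def B1_def)
  have pos: "0 \<le> v x * (1 + r x)\<^sup>2 * exp (l * r x)" for x
    using v[of x] by simp
  \<comment> \<open>The summand 1 in \<open>1 + norm (g x)\<close> covers the denominators, where
    \<open>g\<close> is replaced by the constant 1.\<close>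
  have g: "norm (g x) * (v x * (1 + r x)\<^sup>2 * exp (l * r x)) \<le> ?W x"
    and one: "norm (1::real) * (v x * (1 + r x)\<^sup>2 * exp (l * r x)) \<le> ?W x" for x
    by (intro mult_right_mono pos; simp)+
  note boundsA = exp_tilt_integral_bounds[OF assms(1-3) v r W g, folded A A1 m_def]
  note boundsB = exp_tilt_integral_bounds[OF assms(1,2) borel_measurable_const v r W one, simplified,
      folded B B1 m_def]
  note expA = exp_tilt_integral_expansion[OF assms(1-3) v r W g, folded A A1 m_def]
  note expB = exp_tilt_integral_expansion[OF assms(1,2) borel_measurable_const v r W one, simplified,
      folded B B1 m_def]
  \<comment> \<open>The value at \<theta> = 0 bounds all denominators from below and plays the part
    of \<open>b\<close> in the quotient expansion.\<close>
  have lower: "integral\<^sup>L M v \<le> B \<theta>" if "0 \<le> \<theta>" "\<theta> \<le> l" for \<theta>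
    unfolding B_def
  proof (rule integral_mono)
    show "integrable M v"
      using boundsB(1)[of 0] l by simp
    show "integrable M (\<lambda>x. exp (\<theta> * r x) * v x)"
      using boundsB(1) that by simp
    show "v x \<le> exp (\<theta> * r x) * v x" for x
      using mult_right_mono[of 1 "exp (\<theta> * r x)" "v x"] v[of x] r[of x] that by simp
  qed
  show ?thesis
  proof (rule that)
    fix \<theta> h :: real
    assume *: "0 \<le> \<theta>" "0 \<le> h" "\<theta> + h \<le> l"
    show "norm (A (\<theta> + h) /\<^sub>R B (\<theta> + h)
       - (A \<theta> /\<^sub>R B \<theta> + h *\<^sub>R (A1 \<theta> /\<^sub>R B \<theta> - (B1 \<theta> / B \<theta>) *\<^sub>R (A \<theta> /\<^sub>R B \<theta>))))
      \<le> (m + m * (m / integral\<^sup>L M v) + (m + l * m) * (m / integral\<^sup>L M v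
          + m / integral\<^sup>L M v * (m / integral\<^sup>L M v))) / integral\<^sup>L M v * h\<^sup>2"
      using * b by (intro quotient_expansion lower boundsA boundsB expA expB) auto
  qed
qed

section \<open>The Gaussian kernel and its score\<close>

text \<open>\<open>matrix_inv\<close> is a choice among two-sided inverses. Exhibiting one inverse
  makes the chosen matrix satisfy the inverse equation, and for a scalar matrix this equation
  determines it.\<close>

lemma matrix_inv_scaleR_mat:
  assumes "c \<noteq> 0"
  shows "matrix_inv (c *\<^sub>R mat 1 :: real ^ 'n ^ 'n) = inverse c *\<^sub>R mat 1"
proof -
  let ?A = "c *\<^sub>R mat 1 :: real ^ 'n ^ 'n"
  have "?A ** (inverse c *\<^sub>R mat 1) = mat 1" "(inverse c *\<^sub>R mat 1) ** ?A = mat 1"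
    using assms by (simp_all add: matrix_scalar_ac flip: scalar_matrix_assoc)
  then have "?A ** matrix_inv ?A = mat 1"
    by (metis (mono_tags, lifting) matrix_inv_def someI)
  then have "c *\<^sub>R matrix_inv ?A = mat 1"
    by (simp flip: scalar_matrix_assoc)
  then show ?thesis
    using assms by (metis scaleR_scaleR left_inverse scaleR_one)
qed

lemma forward_kernel_eq:
  fixes xt x0 :: "real ^ 'n"
  assumes "0 < \<sigma> t"
  shows "forward_kernel \<alpha> \<sigma> t xt x0 =
    exp (- (norm (xt - \<alpha> t *\<^sub>R x0))\<^sup>2 / (2 * (\<sigma> t)\<^sup>2)) / sqrt ((2 * pi * (\<sigma> t)\<^sup>2) ^ CARD('n))"
proof -
  let ?v = "xt - \<alpha> t *\<^sub>R x0" and ?S = "(\<sigma> t)\<^sup>2 *\<^sub>R mat 1 :: real ^ 'n ^ 'n"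
  have "c *\<^sub>R mat 1 = (mat c :: real ^ 'n ^ 'n)" for c :: real
    by (simp add: mat_def vec_eq_iff)
  then have det: "det ((2 * pi) *\<^sub>R ?S) = (2 * pi * (\<sigma> t)\<^sup>2) ^ CARD('n)"
    unfolding scaleR_scaleR using det_matrix_scaleR[unfolded matrix_scaleR] by simp
  have "(c *\<^sub>R mat 1) *v ?v = c *\<^sub>R ?v" for c
    by (metis matrix_vector_mul_lid scaleR_matrix_vector_assoc)
  then have "matrix_inv ?S *v ?v = ?v /\<^sub>R (\<sigma> t)\<^sup>2"
    using assms by (simp add: matrix_inv_scaleR_mat)
  then have exponent: "- (1 / 2) * (?v \<bullet> (matrix_inv ?S *v ?v)) = - (norm ?v)\<^sup>2 / (2 * (\<sigma> t)\<^sup>2)"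
    by (simp only: inner_scaleR_right power2_norm_eq_inner) (simp add: field_simps)
  show ?thesis
    unfolding forward_kernel_def gaussian_density_def det exponent ..
qed

text \<open>Closed form of the gradient of the log-kernel in its noised argument. Measurability and
  bounds are stated for it, since \<open>gradient\<close> itself is a definite description.\<close>

definition kernel_score ::
    "(real \<Rightarrow> real) \<Rightarrow> (real \<Rightarrow> real) \<Rightarrow> real \<Rightarrow> real ^ 'n \<Rightarrow> real ^ 'n \<Rightarrow> real ^ 'n" where
  "kernel_score \<alpha> \<sigma> t xt x0 = (\<alpha> t *\<^sub>R x0 - xt) /\<^sub>R (\<sigma> t)\<^sup>2"

lemma borel_measurable_kernel_score [measurable]:
  "kernel_score \<alpha> \<sigma> t xt \<in> borel_measurable borel"
  unfolding kernel_score_def by measurable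

lemma gradient_ln_forward_kernel:
  fixes xt x0 :: "real ^ 'n"
  assumes "0 < \<sigma> t"
  shows "gradient (\<lambda>x. ln (forward_kernel \<alpha> \<sigma> t x x0)) xt = kernel_score \<alpha> \<sigma> t xt x0"
proof (rule gradient_eqI)
  have eq: "(\<lambda>x. ln (forward_kernel \<alpha> \<sigma> t x x0)) =
      (\<lambda>x. - ((x - \<alpha> t *\<^sub>R x0) \<bullet> (x - \<alpha> t *\<^sub>R x0)) / (2 * (\<sigma> t)\<^sup>2) - ln (sqrt ((2 * pi * (\<sigma> t)\<^sup>2) ^ CARD('n))))"
    using assms by (simp add: forward_kernel_eq ln_div power2_norm_eq_inner)
  show "GDERIV (\<lambda>x. ln (forward_kernel \<alpha> \<sigma> t x x0)) xt :> kernel_score \<alpha> \<sigma> t xt x0"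
    unfolding eq gderiv_def kernel_score_def using assms
    by (auto intro!: derivative_eq_intros simp: inner_diff_left inner_diff_right inner_commute field_simps)
qed

lemma borel_measurable_forward_kernel [measurable]:
  fixes xt :: "real ^ 'n"
  assumes "0 < \<sigma> t"
  shows "forward_kernel \<alpha> \<sigma> t xt \<in> borel_measurable borel"
  unfolding forward_kernel_eq[where \<sigma> = \<sigma> and t = t, OF assms, abs_def] by measurable

lemma forward_kernel_pos:
  assumes "0 < \<sigma> t"
  shows "0 < forward_kernel \<alpha> \<sigma> t xt x0"
  using assms by (simp add: forward_kernel_eq)

lemma forward_kernel_le:
  fixes xt x0 :: "real ^ 'n"
  assumes "0 < \<sigma> t"
  shows "forward_kernel \<alpha> \<sigma> t xt x0 \<le> 1 / sqrt ((2 * pi * (\<sigma> t)\<^sup>2) ^ CARD('n))"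
  using assms by (simp add: forward_kernel_eq divide_right_mono)

text \<open>In the variable z = n / s this is z \<le> 1 + z^2 / 2 \<le> exp (z^2 / 2).\<close>

lemma gauss_norm_le:
  fixes n s :: real
  assumes "0 < s"
  shows "exp (- n\<^sup>2 / (2 * s\<^sup>2)) * (n / s\<^sup>2) \<le> 1 / s"
proof -
  define z where "z = n / s"
  have z: "n = z * s" using assms by (simp add: z_def)
  have "0 \<le> (z - 1)\<^sup>2" by simp
  then have "z \<le> 1 + z\<^sup>2 / 2"
    unfolding power2_diff by simp
  also have "\<dots> \<le> exp (z\<^sup>2 / 2)"
    by (rule exp_ge_add_one_self)
  finally have "exp (- (z\<^sup>2 / 2)) * z \<le> 1"
    by (simp add: exp_minus divide_inverse_commute[symmetric] divide_le_eq)
  then have "exp (- (z\<^sup>2 / 2)) * z / s \<le> 1 / s"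
    using assms by (intro divide_right_mono) auto
  moreover have eqs: "- n\<^sup>2 / (2 * s\<^sup>2) = - (z\<^sup>2 / 2)" "n / s\<^sup>2 = z / s"
    unfolding z using assms by (simp_all add: power2_eq_square)
  ultimately show ?thesis
    unfolding eqs by simp
qed

text \<open>The Gaussian absorbs the linear growth of its score, with a constant independent of
  \<open>x0\<close>; score integrals therefore exist against every integrable density.\<close>

lemma forward_kernel_score_le:
  fixes xt x0 :: "real ^ 'n"
  assumes "0 < \<sigma> t"
  shows "forward_kernel \<alpha> \<sigma> t xt x0 * norm (kernel_score \<alpha> \<sigma> t xt x0)
    \<le> 1 / sqrt ((2 * pi * (\<sigma> t)\<^sup>2) ^ CARD('n)) * (1 / \<sigma> t)"
proof -
  let ?s = "\<sigma> t" and ?n = "norm (xt - \<alpha> t *\<^sub>R x0)"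
  have score: "norm (kernel_score \<alpha> \<sigma> t xt x0) = ?n / ?s\<^sup>2"
    by (simp add: kernel_score_def norm_minus_commute divide_inverse)
  have "exp (- ?n\<^sup>2 / (2 * ?s\<^sup>2)) * (?n / ?s\<^sup>2) \<le> 1 / ?s"
    using assms by (rule gauss_norm_le)
  then have "exp (- ?n\<^sup>2 / (2 * ?s\<^sup>2)) * (?n / ?s\<^sup>2) / sqrt ((2 * pi * ?s\<^sup>2) ^ CARD('n))
      \<le> 1 / ?s / sqrt ((2 * pi * ?s\<^sup>2) ^ CARD('n))"
    by (intro divide_right_mono) auto
  then show ?thesis
    using assms by (simp add: forward_kernel_eq score mult_ac)
qed

text \<open>The right-hand side is free of \<open>x0\<close>, so the bound survives integration over
  the clean sample.\<close>

lemma forward_kernel_taylor: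
  fixes xt x0 h :: "real ^ 'n"
  assumes "0 < \<sigma> t"
  shows "\<bar>forward_kernel \<alpha> \<sigma> t (xt + h) x0 - forward_kernel \<alpha> \<sigma> t xt x0
      - forward_kernel \<alpha> \<sigma> t xt x0 * (h \<bullet> kernel_score \<alpha> \<sigma> t xt x0)\<bar>
    \<le> 1 / sqrt ((2 * pi * (\<sigma> t)\<^sup>2) ^ CARD('n)) * ((norm h)\<^sup>2 / (\<sigma> t)\<^sup>2)"
proof -
  let ?u = "xt - \<alpha> t *\<^sub>R x0" and ?c = "sqrt ((2 * pi * (\<sigma> t)\<^sup>2) ^ CARD('n))"
  let ?E = "exp (- (norm (?u + h))\<^sup>2 / (2 * (\<sigma> t)\<^sup>2)) - exp (- (norm ?u)\<^sup>2 / (2 * (\<sigma> t)\<^sup>2))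
           + exp (- (norm ?u)\<^sup>2 / (2 * (\<sigma> t)\<^sup>2)) * (h \<bullet> ?u) / (\<sigma> t)\<^sup>2"
  have "h \<bullet> kernel_score \<alpha> \<sigma> t xt x0 = - (h \<bullet> ?u) / (\<sigma> t)\<^sup>2"
    by (simp add: kernel_score_def inner_diff_right divide_inverse)
  moreover have "xt + h - \<alpha> t *\<^sub>R x0 = ?u + h" by simp
  ultimately have "forward_kernel \<alpha> \<sigma> t (xt + h) x0 - forward_kernel \<alpha> \<sigma> t xt x0
      - forward_kernel \<alpha> \<sigma> t xt x0 * (h \<bullet> kernel_score \<alpha> \<sigma> t xt x0) = ?E / ?c"
    by (simp only: forward_kernel_eq[where \<sigma> = \<sigma> and t = t, OF assms]) (simp add: diff_divide_distrib add_divide_distrib)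
  moreover have "\<bar>?E\<bar> / ?c \<le> ((norm h)\<^sup>2 / (\<sigma> t)\<^sup>2) / ?c"
    using assms by (intro divide_right_mono gauss_taylor) auto
  ultimately show ?thesis
    using assms by (simp add: abs_divide mult_ac)
qed

section \<open>The noised density, its score and the posterior covariance\<close>

lemma integrable_forward_kernel:
  fixes p :: "real ^ 'n \<Rightarrow> real"
  assumes "0 < \<sigma> t" and p: "integrable lborel p"
  shows "integrable lborel (\<lambda>x0. forward_kernel \<alpha> \<sigma> t xt x0 * p x0)"
    and "integrable lborel (\<lambda>x0. (forward_kernel \<alpha> \<sigma> t xt x0 * p x0) *\<^sub>R kernel_score \<alpha> \<sigma> t xt x0)"
proof -
  let ?c = "1 / sqrt ((2 * pi * (\<sigma> t)\<^sup>2) ^ CARD('n))"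
  note [measurable] = borel_measurable_forward_kernel[where \<sigma> = \<sigma> and t = t, OF assms(1)]
  have [measurable]: "p \<in> borel_measurable borel"
    using p by (simp add: borel_measurable_integrable flip: measurable_lborel1)
  show "integrable lborel (\<lambda>x0. forward_kernel \<alpha> \<sigma> t xt x0 * p x0)"
  proof (rule Bochner_Integration.integrable_bound)
    show "integrable lborel (\<lambda>x. ?c * p x)" using p by simp
    show "AE x in lborel. norm (forward_kernel \<alpha> \<sigma> t xt x * p x) \<le> norm (?c * p x)"
    proof (rule AE_I2)
      fix x
      have "norm (forward_kernel \<alpha> \<sigma> t xt x * p x) = forward_kernel \<alpha> \<sigma> t xt x * \<bar>p x\<bar>"
        using less_imp_le[OF forward_kernel_pos[where \<alpha> = \<alpha> and \<sigma> = \<sigma> and t = t and xt = xt and ?x0.0 = x, OF assms(1)]] by (simp add: abs_mult)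
      also have "\<dots> \<le> ?c * \<bar>p x\<bar>"
        by (intro mult_right_mono forward_kernel_le assms) auto
      also have "\<dots> = norm (?c * p x)"
        using assms(1) by (simp add: abs_mult)
      finally show "norm (forward_kernel \<alpha> \<sigma> t xt x * p x) \<le> norm (?c * p x)" .
    qed
  qed measurable
  show "integrable lborel (\<lambda>x0. (forward_kernel \<alpha> \<sigma> t xt x0 * p x0) *\<^sub>R kernel_score \<alpha> \<sigma> t xt x0)"
  proof (rule Bochner_Integration.integrable_bound)
    show "integrable lborel (\<lambda>x. (?c * (1 / \<sigma> t)) * p x)" using p by simp
    show "AE x in lborel. norm ((forward_kernel \<alpha> \<sigma> t xt x * p x) *\<^sub>R kernel_score \<alpha> \<sigma> t xt x)
        \<le> norm ((?c * (1 / \<sigma> t)) * p x)"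
    proof (rule AE_I2)
      fix x
      have "norm ((forward_kernel \<alpha> \<sigma> t xt x * p x) *\<^sub>R kernel_score \<alpha> \<sigma> t xt x)
          = forward_kernel \<alpha> \<sigma> t xt x * norm (kernel_score \<alpha> \<sigma> t xt x) * \<bar>p x\<bar>"
        using less_imp_le[OF forward_kernel_pos[where \<alpha> = \<alpha> and \<sigma> = \<sigma> and t = t and xt = xt and ?x0.0 = x, OF assms(1)]] by (simp add: abs_mult)
      also have "\<dots> \<le> (?c * (1 / \<sigma> t)) * \<bar>p x\<bar>"
        by (intro mult_right_mono forward_kernel_score_le assms) auto
      also have "\<dots> = norm ((?c * (1 / \<sigma> t)) * p x)"
        using assms(1) by (simp add: abs_mult)
      finally show "norm ((forward_kernel \<alpha> \<sigma> t xt x * p x) *\<^sub>R kernel_score \<alpha> \<sigma> t xt x)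
          \<le> norm ((?c * (1 / \<sigma> t)) * p x)" .
    qed
  qed measurable
qed

text \<open>Integrating the uniform Taylor bound against \<open>\<bar>p y\<bar>\<close> leaves a
  remainder quadratic in \<open>h\<close>, which justifies differentiating under the
  integral.\<close>

lemma GDERIV_noised_density:
  fixes p :: "real ^ 'n \<Rightarrow> real"
  assumes "0 < \<sigma> t" and p: "integrable lborel p"
  shows "GDERIV (noised_density \<alpha> \<sigma> t p) xt :>
    (LINT x0|lborel. (forward_kernel \<alpha> \<sigma> t xt x0 * p x0) *\<^sub>R kernel_score \<alpha> \<sigma> t xt x0)"
proof (rule GDERIV_of_quadratic_remainder)
  fix h :: "real ^ 'n"
  let ?c = "1 / sqrt ((2 * pi * (\<sigma> t)\<^sup>2) ^ CARD('n))"
  let ?q = "forward_kernel \<alpha> \<sigma> t" and ?g = "kernel_score \<alpha> \<sigma> t"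
  note int = integrable_forward_kernel[where \<alpha> = \<alpha> and \<sigma> = \<sigma> and t = t, OF assms]
  let ?e = "\<lambda>y. ?q (xt + h) y * p y - ?q xt y * p y - h \<bullet> ((?q xt y * p y) *\<^sub>R ?g xt y)"
  have eq: "noised_density \<alpha> \<sigma> t p (xt + h) - noised_density \<alpha> \<sigma> t p xt
      - h \<bullet> (LINT y|lborel. (?q xt y * p y) *\<^sub>R ?g xt y) = (LINT y|lborel. ?e y)"
    unfolding noised_density_def using int by (simp del: inner_scaleR_right)
  have "norm (LINT y|lborel. ?e y) \<le> (LINT y|lborel. (?c * ((norm h)\<^sup>2 / (\<sigma> t)\<^sup>2)) * \<bar>p y\<bar>)"
  proof (rule Bochner_Integration.integral_norm_bound_integral)
    show "integrable lborel ?e"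
      using int by (simp del: inner_scaleR_right)
    show "integrable lborel (\<lambda>y. (?c * ((norm h)\<^sup>2 / (\<sigma> t)\<^sup>2)) * \<bar>p y\<bar>)"
      using p by simp
    fix y
    have "?e y = (?q (xt + h) y - ?q xt y - ?q xt y * (h \<bullet> ?g xt y)) * p y"
      by (simp add: algebra_simps)
    then show "norm (?e y) \<le> (?c * ((norm h)\<^sup>2 / (\<sigma> t)\<^sup>2)) * \<bar>p y\<bar>"
      unfolding real_norm_def abs_mult
      by (metis abs_ge_zero abs_mult mult_right_mono forward_kernel_taylor[where \<sigma> = \<sigma> and t = t, OF assms(1)])
  qed
  also have "\<dots> = (?c / (\<sigma> t)\<^sup>2 * (LINT y|lborel. \<bar>p y\<bar>)) * (norm h)\<^sup>2"
    by simp
  finally have "norm (LINT y|lborel. ?e y) \<le> (?c / (\<sigma> t)\<^sup>2 * (LINT y|lborel. \<bar>p y\<bar>)) * (norm h)\<^sup>2" .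
  then show "\<bar>noised_density \<alpha> \<sigma> t p (xt + h) - noised_density \<alpha> \<sigma> t p xt
      - h \<bullet> (LINT y|lborel. (?q xt y * p y) *\<^sub>R ?g xt y)\<bar>
      \<le> (?c / (\<sigma> t)\<^sup>2 * (LINT y|lborel. \<bar>p y\<bar>)) * (norm h)\<^sup>2"
    unfolding eq real_norm_def .
qed

text \<open>The kernel never vanishes, so a zero integral would force \<open>p\<close> to vanish
  almost everywhere.\<close>

lemma noised_density_pos:
  fixes p :: "real ^ 'n \<Rightarrow> real"
  assumes "0 < \<sigma> t" and p: "integrable lborel p" "\<And>x. 0 \<le> p x" "integral\<^sup>L lborel p \<noteq> 0"
  shows "0 < noised_density \<alpha> \<sigma> t p xt"
proof -
  note q = forward_kernel_pos[where \<sigma> = \<sigma> and t = t, OF assms(1)]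
  have nonneg: "AE x in lborel. 0 \<le> forward_kernel \<alpha> \<sigma> t xt x * p x"
    using p(2) by (intro AE_I2 mult_nonneg_nonneg less_imp_le[OF q])
  have "noised_density \<alpha> \<sigma> t p xt \<noteq> 0"
  proof
    assume "noised_density \<alpha> \<sigma> t p xt = 0"
    then have "AE x in lborel. forward_kernel \<alpha> \<sigma> t xt x * p x = 0"
      unfolding noised_density_def
      using integral_nonneg_eq_0_iff_AE[OF integrable_forward_kernel(1)[where \<sigma> = \<sigma> and t = t, OF assms(1) p(1)] nonneg]
      by simp
    then have "AE x in lborel. p x = 0"
      using q by (auto simp: less_le)
    then show False
      using p(3) integral_eq_zero_AE by blast
  qed
  moreover have "0 \<le> noised_density \<alpha> \<sigma> t p xt"
    unfolding noised_density_def using nonneg by (rule integral_nonneg_AE)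
  ultimately show ?thesis by simp
qed

text \<open>The logarithmic derivative turns the score into the posterior mean of the kernel score.
  The total mass of \<open>p\<close> is only required to be nonzero, so unnormalised weights are
  covered.\<close>

lemma
  fixes p :: "real ^ 'n \<Rightarrow> real"
  assumes "0 < \<sigma> t" "integrable lborel p" "\<And>x. 0 \<le> p x" "integral\<^sup>L lborel p \<noteq> 0"
  shows differentiable_ln_noised_density:
      "(\<lambda>x. ln (noised_density \<alpha> \<sigma> t p x)) differentiable (at xt)"
    and score_eq: "score \<alpha> \<sigma> t p xt =
      (LINT y|lborel. (forward_kernel \<alpha> \<sigma> t xt y * p y) *\<^sub>R kernel_score \<alpha> \<sigma> t xt y)
        /\<^sub>R (LINT y|lborel. forward_kernel \<alpha> \<sigma> t xt y * p y)"
proof -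
  have G: "GDERIV (\<lambda>x. ln (noised_density \<alpha> \<sigma> t p x)) xt :>
      (LINT y|lborel. (forward_kernel \<alpha> \<sigma> t xt y * p y) *\<^sub>R kernel_score \<alpha> \<sigma> t xt y)
        /\<^sub>R noised_density \<alpha> \<sigma> t p xt"
    using assms
    by (intro GDERIV_DERIV_compose[OF GDERIV_noised_density DERIV_ln] noised_density_pos)
  then show "(\<lambda>x. ln (noised_density \<alpha> \<sigma> t p x)) differentiable (at xt)"
    unfolding gderiv_def differentiable_def by blast
  show "score \<alpha> \<sigma> t p xt =
      (LINT y|lborel. (forward_kernel \<alpha> \<sigma> t xt y * p y) *\<^sub>R kernel_score \<alpha> \<sigma> t xt y)
        /\<^sub>R (LINT y|lborel. forward_kernel \<alpha> \<sigma> t xt y * p y)"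
    unfolding score_def gradient_eqI[OF G] unfolding noised_density_def ..
qed

text \<open>Dividing by the mass of \<open>q\<close> only at the end brings the covariance into
  exactly the shape of the first-order term of \<open>exp_tilt_mean_expansion\<close>.\<close>

lemma score_cov_eq:
  fixes p r :: "real ^ 'n \<Rightarrow> real" and \<alpha> \<sigma> :: "real \<Rightarrow> real" and xt :: "real ^ 'n"
  assumes "0 < \<sigma> t" and [measurable]: "p \<in> borel_measurable borel" "r \<in> borel_measurable borel"
    and "\<And>x. 0 \<le> p x"
  defines "q \<equiv> \<lambda>y. forward_kernel \<alpha> \<sigma> t xt y * p y"
    and "g \<equiv> kernel_score \<alpha> \<sigma> t xt"
  shows "score_cov \<alpha> \<sigma> t p r xt =
    (LINT y|lborel. (q y * r y) *\<^sub>R g y) /\<^sub>R integral\<^sup>L lborel q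
     - ((LINT y|lborel. q y * r y) / integral\<^sup>L lborel q)
        *\<^sub>R ((LINT y|lborel. q y *\<^sub>R g y) /\<^sub>R integral\<^sup>L lborel q)"
proof -
  note [measurable] = borel_measurable_forward_kernel[where \<sigma> = \<sigma> and t = t, OF assms(1)]
  have [measurable]: "q \<in> borel_measurable borel" "g \<in> borel_measurable borel"
    unfolding q_def g_def by measurable
  let ?B = "integral\<^sup>L lborel q"
  have q: "0 \<le> q y" for y
    unfolding q_def using assms(1,4) by (intro mult_nonneg_nonneg less_imp_le[OF forward_kernel_pos])
  then have "0 \<le> ?B" by simp
  have post: "posterior_density \<alpha> \<sigma> t p xt = (\<lambda>y. q y / ?B)"
    unfolding posterior_density_def q_def by (simp add: mult.commute)
  have int: "integral\<^sup>L (density lborel (\<lambda>x. ennreal (posterior_density \<alpha> \<sigma> t p xt x))) f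
      = (LINT y|lborel. q y *\<^sub>R f y) /\<^sub>R ?B"
    if [measurable]: "f \<in> borel_measurable borel"
    for f :: "real ^ 'n \<Rightarrow> 'b::{banach, second_countable_topology}"
  proof -
    have "integral\<^sup>L (density lborel (\<lambda>x. ennreal (posterior_density \<alpha> \<sigma> t p xt x))) f
        = (LINT y|lborel. (q y / ?B) *\<^sub>R f y)"
      unfolding post using q \<open>0 \<le> ?B\<close> by (intro integral_density) auto
    also have "\<dots> = (LINT y|lborel. inverse ?B *\<^sub>R (q y *\<^sub>R f y))"
      by (simp only: divide_inverse scaleR_scaleR mult.commute)
    finally show ?thesis
      by (simp only: integral_scaleR_right)
  qed
  show ?thesis
    unfolding score_cov_def cov_under_def Let_def gradient_ln_forward_kernel[where \<sigma> = \<sigma> and t = t, OF assms(1)]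
      g_def[symmetric]
    by (simp add: int divide_inverse_commute)
qed

lemma score_divide:
  fixes p :: "real ^ 'n \<Rightarrow> real"
  assumes "0 < \<sigma> t" "integrable lborel p" "\<And>x. 0 \<le> p x" "integral\<^sup>L lborel p \<noteq> 0" "0 < Z"
  shows "score \<alpha> \<sigma> t (\<lambda>y. p y / Z) xt = score \<alpha> \<sigma> t p xt"
proof -
  have "(LINT y|lborel. (forward_kernel \<alpha> \<sigma> t xt y * (p y / Z)) *\<^sub>R kernel_score \<alpha> \<sigma> t xt y)
      = (LINT y|lborel. inverse Z *\<^sub>R ((forward_kernel \<alpha> \<sigma> t xt y * p y) *\<^sub>R kernel_score \<alpha> \<sigma> t xt y))"
    by (intro Bochner_Integration.integral_cong) (auto simp: divide_inverse mult_ac)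
  then have "(LINT y|lborel. (forward_kernel \<alpha> \<sigma> t xt y * (p y / Z)) *\<^sub>R kernel_score \<alpha> \<sigma> t xt y)
      = (LINT y|lborel. (forward_kernel \<alpha> \<sigma> t xt y * p y) *\<^sub>R kernel_score \<alpha> \<sigma> t xt y) /\<^sub>R Z"
    by (simp only: integral_scaleR_right)
  then show ?thesis
    using assms score_eq[where \<alpha> = \<alpha> and \<sigma> = \<sigma> and t = t and xt = xt and p = p]
      score_eq[where \<alpha> = \<alpha> and \<sigma> = \<sigma> and t = t and xt = xt and p = "\<lambda>y. p y / Z"]
    by (simp add: inverse_eq_divide)
qed

lemma score_cov_divide:
  assumes "Z \<noteq> 0"
  shows "score_cov \<alpha> \<sigma> t (\<lambda>y. p y / Z) r xt = score_cov \<alpha> \<sigma> t p r xt"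
proof -
  have "posterior_density \<alpha> \<sigma> t (\<lambda>y. p y / Z) xt = posterior_density \<alpha> \<sigma> t p xt"
    unfolding posterior_density_def using assms by simp
  then show ?thesis
    by (simp add: score_cov_def)
qed

section \<open>Integrability and domination for tilted weights\<close>

text \<open>A gap \<theta> < l buys one moment of \<open>r\<close>, because (l - \<theta>) r \<le>
  exp ((l - \<theta>) r). At \<theta> = l this moment may diverge, hence the strict inequality in
  the second claim.\<close>

lemma integrable_exp_tilt:
  fixes p r :: "real ^ 'n \<Rightarrow> real"
  assumes [measurable]: "p \<in> borel_measurable borel" "r \<in> borel_measurable borel"
    and p: "\<And>x. 0 \<le> p x" and r: "\<And>x. 0 \<le> r x"
    and int: "integrable lborel (\<lambda>x. exp (l * r x) * p x)"
    and \<theta>: "\<theta> \<le> l"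
  shows "integrable lborel (\<lambda>x. exp (\<theta> * r x) * p x)"
    and "\<theta> < l \<Longrightarrow> integrable lborel (\<lambda>x. exp (\<theta> * r x) * p x * r x)"
proof -
  show "integrable lborel (\<lambda>x. exp (\<theta> * r x) * p x)"
  proof (rule Bochner_Integration.integrable_bound[OF int])
    show "AE x in lborel. norm (exp (\<theta> * r x) * p x) \<le> norm (exp (l * r x) * p x)"
      using p r \<theta> by (intro AE_I2) (auto simp: abs_mult intro!: mult_right_mono)
  qed measurable
  assume "\<theta> < l"
  show "integrable lborel (\<lambda>x. exp (\<theta> * r x) * p x * r x)"
  proof (rule Bochner_Integration.integrable_bound)
    show "integrable lborel (\<lambda>x. (1 / (l - \<theta>)) * (exp (l * r x) * p x))"
      using int by simp
    show "AE x in lborel. norm (exp (\<theta> * r x) * p x * r x)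
        \<le> norm ((1 / (l - \<theta>)) * (exp (l * r x) * p x))"
    proof (rule AE_I2)
      fix x
      have "(l - \<theta>) * r x \<le> exp ((l - \<theta>) * r x)"
        using exp_ge_add_one_self[of "(l - \<theta>) * r x"] by linarith
      then have "r x \<le> (1 / (l - \<theta>)) * exp ((l - \<theta>) * r x)"
        using \<open>\<theta> < l\<close> by (simp add: pos_le_divide_eq mult.commute)
      then have "exp (\<theta> * r x) * p x * r x
          \<le> exp (\<theta> * r x) * p x * ((1 / (l - \<theta>)) * exp ((l - \<theta>) * r x))"
        using p by (intro mult_left_mono) auto
      also have "\<dots> = (1 / (l - \<theta>)) * (exp (\<theta> * r x) * exp ((l - \<theta>) * r x) * p x)"
        by simp
      also have "exp (\<theta> * r x) * exp ((l - \<theta>) * r x) = exp (l * r x)"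
        by (simp add: algebra_simps flip: exp_add)
      finally show "norm (exp (\<theta> * r x) * p x * r x) \<le> norm ((1 / (l - \<theta>)) * (exp (l * r x) * p x))"
        using p[of x] r[of x] \<open>\<theta> < l\<close> by (simp add: abs_mult)
    qed
  qed measurable
qed

text \<open>Replacing 1 + z by exp z in the polynomial factors puts everything in one exponent,
  which grows at most linearly in |y| apart from a term - R |y|^2. Since \<alpha> at
  \<open>t\<close> is nonzero, R is positive and the exponent is bounded above.\<close>

lemma forward_kernel_dominates_growth:
  fixes r :: "real ^ 'n \<Rightarrow> real"
  assumes "0 < \<sigma> t" "\<alpha> t \<noteq> 0" "0 \<le> l" and r: "\<And>y. 0 \<le> r y" "\<And>y. r y \<le> C * (1 + norm y)"
  obtains D where "\<And>y. (1 + norm (kernel_score \<alpha> \<sigma> t xt y)) * (1 + r y)\<^sup>2 * exp (l * r y)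
      * forward_kernel \<alpha> \<sigma> t xt y \<le> D"
proof -
  let ?a = "\<alpha> t" and ?s = "\<sigma> t" and ?c = "sqrt ((2 * pi * (\<sigma> t)\<^sup>2) ^ CARD('n))"
  \<comment> \<open>The exponent is bounded by P + Q |y| - R |y|^2. The 2 in \<open>2 + l\<close>
    comes from \<open>(1 + r y)\<^sup>2 \<le> (exp (r y))\<^sup>2\<close>.\<close>
  define R where "R = ?a\<^sup>2 / (4 * ?s\<^sup>2)"
  define Q where "Q = \<bar>?a\<bar> / ?s\<^sup>2 + (2 + l) * C"
  define P where "P = norm xt / ?s\<^sup>2 + (2 + l) * C + (norm xt)\<^sup>2 / (2 * ?s\<^sup>2)"
  have R: "0 < R" using assms by (simp add: R_def)
  have "(1 + norm (kernel_score \<alpha> \<sigma> t xt y)) * (1 + r y)\<^sup>2 * exp (l * r y)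
      * forward_kernel \<alpha> \<sigma> t xt y \<le> exp (P + Q\<^sup>2 / (4 * R)) / ?c" for y
  proof -
    let ?g = "norm (kernel_score \<alpha> \<sigma> t xt y)" and ?d = "norm (xt - ?a *\<^sub>R y)" and ?n = "norm y"
    have "?g = norm (?a *\<^sub>R y - xt) / ?s\<^sup>2"
      by (simp add: kernel_score_def divide_inverse)
    also have "\<dots> \<le> (\<bar>?a\<bar> * ?n + norm xt) / ?s\<^sup>2"
      using norm_triangle_ineq4[of "?a *\<^sub>R y" xt] by (intro divide_right_mono) auto
    finally have g: "?g \<le> \<bar>?a\<bar> / ?s\<^sup>2 * ?n + norm xt / ?s\<^sup>2"
      by (simp add: add_divide_distrib)
    have "(2 + l) * r y \<le> (2 + l) * (C * (1 + ?n))"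
      using r assms by (intro mult_left_mono) auto
    then have lr: "(2 + l) * r y \<le> (2 + l) * C + (2 + l) * C * ?n"
      by (simp add: algebra_simps)
    \<comment> \<open>The Gaussian decays in the distance \<open>?d\<close>. Passing to |y| through
      (c + d)^2 \<le> 2 c^2 + 2 d^2 loses a factor 2, which explains the 4 in the denominator of
      \<open>R\<close>.\<close>
    have "\<bar>?a\<bar> * ?n \<le> ?d + norm xt"
      using norm_triangle_ineq4[of xt "xt - ?a *\<^sub>R y"] by simp
    then have "(\<bar>?a\<bar> * ?n)\<^sup>2 \<le> (?d + norm xt)\<^sup>2"
      by (intro power_mono) auto
    also have "\<dots> \<le> 2 * ?d\<^sup>2 + 2 * (norm xt)\<^sup>2"
      using zero_le_power2[of "?d - norm xt"] by (simp add: power2_sum power2_diff)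
    finally have "- ?d\<^sup>2 \<le> (norm xt)\<^sup>2 - ?a\<^sup>2 * ?n\<^sup>2 / 2"
      by (simp add: power_mult_distrib)
    then have "- ?d\<^sup>2 / (2 * ?s\<^sup>2) \<le> ((norm xt)\<^sup>2 - ?a\<^sup>2 * ?n\<^sup>2 / 2) / (2 * ?s\<^sup>2)"
      by (intro divide_right_mono) auto
    also have "\<dots> = (norm xt)\<^sup>2 / (2 * ?s\<^sup>2) - R * ?n\<^sup>2"
      by (simp add: R_def diff_divide_distrib)
    finally have d: "- ?d\<^sup>2 / (2 * ?s\<^sup>2) \<le> (norm xt)\<^sup>2 / (2 * ?s\<^sup>2) - R * ?n\<^sup>2" .
    \<comment> \<open>Completing the square: \<open>Q\<^sup>2 / (4 * R)\<close> is the maximum over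
      real n of Q n - R n^2.\<close>
    have "Q\<^sup>2 / (4 * R) - Q * ?n + R * ?n\<^sup>2 = R * (?n - Q / (2 * R))\<^sup>2"
      using R by (simp add: power2_diff field_simps power2_eq_square)
    moreover have "0 \<le> R * (?n - Q / (2 * R))\<^sup>2"
      using R by simp
    ultimately have "Q * ?n - R * ?n\<^sup>2 \<le> Q\<^sup>2 / (4 * R)"
      by linarith
    moreover have "Q * ?n = \<bar>?a\<bar> / ?s\<^sup>2 * ?n + (2 + l) * C * ?n"
      unfolding Q_def by (rule distrib_right)
    ultimately have "?g + (2 + l) * r y + - ?d\<^sup>2 / (2 * ?s\<^sup>2) \<le> P + Q\<^sup>2 / (4 * R)"
      using g lr d unfolding P_def by linarith
    then have le: "exp (?g + (2 + l) * r y + - ?d\<^sup>2 / (2 * ?s\<^sup>2)) \<le> exp (P + Q\<^sup>2 / (4 * R))"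
      by simp
    have "(1 + r y)\<^sup>2 \<le> (exp (r y))\<^sup>2"
      using r(1)[of y] exp_ge_add_one_self[of "r y"] by (intro power_mono) auto
    then have "(1 + ?g) * (1 + r y)\<^sup>2 \<le> exp ?g * (exp (r y))\<^sup>2"
      using exp_ge_add_one_self[of ?g] by (intro mult_mono) auto
    then have "(1 + ?g) * (1 + r y)\<^sup>2 * exp (l * r y) * exp (- ?d\<^sup>2 / (2 * ?s\<^sup>2))
        \<le> exp ?g * (exp (r y))\<^sup>2 * exp (l * r y) * exp (- ?d\<^sup>2 / (2 * ?s\<^sup>2))"
      by (intro mult_right_mono) auto
    also have "\<dots> = exp (?g + (2 + l) * r y + - ?d\<^sup>2 / (2 * ?s\<^sup>2))"
      unfolding power2_eq_square exp_add[symmetric] by (simp add: algebra_simps)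
    also note le
    finally have "(1 + ?g) * (1 + r y)\<^sup>2 * exp (l * r y) * exp (- ?d\<^sup>2 / (2 * ?s\<^sup>2))
        \<le> exp (P + Q\<^sup>2 / (4 * R))" .
    from divide_right_mono[OF this, of ?c] show ?thesis
      using assms(1) by (simp add: forward_kernel_eq)
  qed
  then show ?thesis by (rule that)
qed

section \<open>Expansion of the score in the tilt parameter\<close>

lemma score_tilt_constant_kernel:
  fixes p r :: "real ^ 'n \<Rightarrow> real"
  assumes "0 < \<sigma> t" "\<alpha> t = 0" and "p \<in> borel_measurable borel" "r \<in> borel_measurable borel"
    and p: "integrable lborel p" "\<And>x. 0 \<le> p x" "integral\<^sup>L lborel p \<noteq> 0"
  shows "score \<alpha> \<sigma> t p xt = - xt /\<^sub>R (\<sigma> t)\<^sup>2"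
    and "integrable lborel (\<lambda>x. p x * r x) \<Longrightarrow> score_cov \<alpha> \<sigma> t p r xt = 0"
proof -
  let ?q = "\<lambda>y. forward_kernel \<alpha> \<sigma> t xt y * p y" and ?g = "- xt /\<^sub>R (\<sigma> t)\<^sup>2"
  have g: "kernel_score \<alpha> \<sigma> t xt y = ?g" for y
    using assms by (simp add: kernel_score_def)
  have q: "integrable lborel ?q"
    using assms by (intro integrable_forward_kernel)
  have pos: "0 < integral\<^sup>L lborel ?q"
    using noised_density_pos[where \<alpha> = \<alpha> and \<sigma> = \<sigma> and t = t, OF assms(1) p] by (simp add: noised_density_def)
  have mean: "(LINT y|lborel. ?q y *\<^sub>R ?g) = integral\<^sup>L lborel ?q *\<^sub>R ?g"
    using q by (intro integral_scaleR_left)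
  show "score \<alpha> \<sigma> t p xt = ?g"
    unfolding score_eq[where \<alpha> = \<alpha> and \<sigma> = \<sigma> and t = t, OF assms(1) p] g mean using pos by simp
  assume "integrable lborel (\<lambda>x. p x * r x)"
  \<comment> \<open>The kernel is bounded in the clean sample, so
    \<open>integrable_forward_kernel\<close> applies with \<open>p x * r x\<close> in the role of
    the density.\<close>
  then have "integrable lborel (\<lambda>y. ?q y * r y)"
    using integrable_forward_kernel(1)[where \<alpha> = \<alpha> and \<sigma> = \<sigma> and t = t and xt = xt, OF assms(1)]
    by (simp add: mult.assoc)
  then have cross: "(LINT y|lborel. (?q y * r y) *\<^sub>R ?g) = (LINT y|lborel. ?q y * r y) *\<^sub>R ?g"
    by (intro integral_scaleR_left)
  show "score_cov \<alpha> \<sigma> t p r xt = 0"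
    unfolding score_cov_eq[where \<alpha> = \<alpha> and \<sigma> = \<sigma> and t = t, OF assms(1,3,4) p(2)] g mean cross
    using pos by (simp add: divide_inverse_commute)
qed

text \<open>The step \<open>h\<close> is strictly positive so that the covariance is taken at a base
  point \<theta> < l. If \<alpha> vanishes at \<open>t\<close>, this gap is what provides the first
  moment of \<open>r\<close>, and the estimate then holds with K = 0.\<close>

lemma score_tilt_expansion:
  fixes p r :: "real ^ 'n \<Rightarrow> real"
  assumes \<sigma>: "0 < \<sigma> t" and l: "0 \<le> l"
    and [measurable]: "r \<in> borel_measurable borel"
    and p: "integrable lborel p" "\<And>x. 0 \<le> p x" "integral\<^sup>L lborel p \<noteq> 0"
    and r: "\<And>x. 0 \<le> r x" "\<And>x. r x \<le> C * (1 + norm x)"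
    and int: "integrable lborel (\<lambda>x. exp (l * r x) * p x)"
  defines "w \<equiv> \<lambda>\<theta> x. exp (\<theta> * r x) * p x"
  obtains K where "\<And>\<theta> h. 0 \<le> \<theta> \<Longrightarrow> 0 < h \<Longrightarrow> \<theta> + h \<le> l \<Longrightarrow>
    norm (score \<alpha> \<sigma> t (w (\<theta> + h)) xt
      - (score \<alpha> \<sigma> t (w \<theta>) xt + h *\<^sub>R score_cov \<alpha> \<sigma> t (w \<theta>) r xt)) \<le> K * h\<^sup>2"
proof -
  have [measurable]: "p \<in> borel_measurable borel"
    using p(1) by (simp add: borel_measurable_integrable flip: measurable_lborel1)
  have [measurable]: "w \<theta> \<in> borel_measurable borel" for \<theta>
    unfolding w_def by measurable
  have w: "integrable lborel (w \<theta>)" "\<And>x. 0 \<le> w \<theta> x" "integral\<^sup>L lborel (w \<theta>) \<noteq> 0"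
    if "0 \<le> \<theta>" "\<theta> \<le> l" for \<theta>
  proof -
    show *: "integrable lborel (w \<theta>)"
      unfolding w_def by (rule integrable_exp_tilt[OF _ _ p(2) r(1) int that(2)]) measurable
    show "0 \<le> w \<theta> x" for x
      using p(2) by (simp add: w_def)
    have "integral\<^sup>L lborel p \<le> integral\<^sup>L lborel (w \<theta>)"
    proof (rule integral_mono[OF p(1) *])
      show "p x \<le> w \<theta> x" for x
        unfolding w_def using mult_right_mono[of 1 "exp (\<theta> * r x)" "p x"] p(2)[of x] r(1)[of x] that by simp
    qed
    moreover have "0 \<le> integral\<^sup>L lborel p"
      using p(2) by simp
    ultimately show "integral\<^sup>L lborel (w \<theta>) \<noteq> 0"
      using p(3) by linarith
  qed
  show ?thesis
  proof (cases "\<alpha> t = 0")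
    case True
    show ?thesis
    proof (rule that)
      fix \<theta> h :: real
      assume *: "0 \<le> \<theta>" "0 < h" "\<theta> + h \<le> l"
      have "integrable lborel (\<lambda>x. w \<theta> x * r x)"
        unfolding w_def using * by (intro integrable_exp_tilt(2)[OF _ _ p(2) r(1) int]) auto
      then have "score_cov \<alpha> \<sigma> t (w \<theta>) r xt = 0"
        using * by (intro score_tilt_constant_kernel \<sigma> True w) auto
      moreover have "score \<alpha> \<sigma> t (w \<theta>') xt = - xt /\<^sub>R (\<sigma> t)\<^sup>2" if "0 \<le> \<theta>'" "\<theta>' \<le> l" for \<theta>'
        using that by (intro score_tilt_constant_kernel(1)[where r = r] \<sigma> True w) auto
      ultimately show "norm (score \<alpha> \<sigma> t (w (\<theta> + h)) xt
          - (score \<alpha> \<sigma> t (w \<theta>) xt + h *\<^sub>R score_cov \<alpha> \<sigma> t (w \<theta>) r xt)) \<le> 0 * h\<^sup>2"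
        using * by simp
    qed
  next
    case False
    let ?g = "kernel_score \<alpha> \<sigma> t xt"
    \<comment> \<open>The kernel is merged into the base weight: tilting acts on \<open>v\<close>,
      and both the score and the covariance become quotients of tilted integrals of
      \<open>v\<close>.\<close>
    define v where "v y = forward_kernel \<alpha> \<sigma> t xt y * p y" for y
    note [measurable] = borel_measurable_forward_kernel[where \<sigma> = \<sigma> and t = t, OF \<sigma>]
    have v_meas: "v \<in> borel_measurable lborel"
      unfolding v_def by measurable
    have q_pos: "0 < forward_kernel \<alpha> \<sigma> t xt y" for y
      using \<sigma> by (rule forward_kernel_pos)
    have v: "0 \<le> v y" for y
      unfolding v_def using p(2) by (intro mult_nonneg_nonneg less_imp_le[OF q_pos])
    have v_pos: "0 < integral\<^sup>L lborel v"
      using noised_density_pos[where \<alpha> = \<alpha> and \<sigma> = \<sigma> and t = t and xt = xt, OF \<sigma> p]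
      by (simp add: noised_density_def v_def[abs_def])
    obtain D where D: "\<And>y. (1 + norm (?g y)) * (1 + r y)\<^sup>2 * exp (l * r y)
      * forward_kernel \<alpha> \<sigma> t xt y \<le> D"
      using forward_kernel_dominates_growth[where \<alpha> = \<alpha> and \<sigma> = \<sigma> and t = t, OF \<sigma> False l r] by blast
    \<comment> \<open>All growth is absorbed by the kernel factor of \<open>v\<close>, leaving
      \<open>D * p x\<close> as an integrable bound.\<close>
    have W: "integrable lborel (\<lambda>x. (1 + norm (?g x)) * (v x * (1 + r x)\<^sup>2 * exp (l * r x)))"
    proof (rule Bochner_Integration.integrable_bound)
      show "integrable lborel (\<lambda>x. D * p x)" using p(1) by simp
      show "(\<lambda>x. (1 + norm (?g x)) * (v x * (1 + r x)\<^sup>2 * exp (l * r x))) \<in> borel_measurable lborel"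
        using v_meas by measurable
      show "AE x in lborel. norm ((1 + norm (?g x)) * (v x * (1 + r x)\<^sup>2 * exp (l * r x))) \<le> norm (D * p x)"
      proof (rule AE_I2)
        fix x
        have "(1 + norm (?g x)) * (v x * (1 + r x)\<^sup>2 * exp (l * r x))
          = (1 + norm (?g x)) * (1 + r x)\<^sup>2 * exp (l * r x) * forward_kernel \<alpha> \<sigma> t xt x * p x"
          unfolding v_def by (simp only: mult_ac)
        also have "\<dots> \<le> D * p x"
          by (rule mult_right_mono[OF D p(2)])
        finally have "(1 + norm (?g x)) * (v x * (1 + r x)\<^sup>2 * exp (l * r x)) \<le> D * p x" .
        moreover have "0 \<le> (1 + norm (?g x)) * (v x * (1 + r x)\<^sup>2 * exp (l * r x))"
          using v by (intro mult_nonneg_nonneg add_nonneg_nonneg) auto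
        ultimately show "norm ((1 + norm (?g x)) * (v x * (1 + r x)\<^sup>2 * exp (l * r x))) \<le> norm (D * p x)"
          unfolding real_norm_def by linarith
      qed
    qed
    have q_w: "forward_kernel \<alpha> \<sigma> t xt y * w \<theta> y = exp (\<theta> * r y) * v y" for \<theta> y
      by (simp add: v_def w_def mult_ac)
    have score: "score \<alpha> \<sigma> t (w \<theta>) xt = (LINT y|lborel. (exp (\<theta> * r y) * v y) *\<^sub>R ?g y)
        /\<^sub>R (LINT y|lborel. exp (\<theta> * r y) * v y)" if "0 \<le> \<theta>" "\<theta> \<le> l" for \<theta>
      unfolding score_eq[where \<alpha> = \<alpha> and \<sigma> = \<sigma> and t = t, OF \<sigma> w[OF that]] q_w ..
    have cov: "score_cov \<alpha> \<sigma> t (w \<theta>) r xt =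
        (LINT y|lborel. (exp (\<theta> * r y) * v y * r y) *\<^sub>R ?g y) /\<^sub>R (LINT y|lborel. exp (\<theta> * r y) * v y)
        - ((LINT y|lborel. exp (\<theta> * r y) * v y * r y) / (LINT y|lborel. exp (\<theta> * r y) * v y))
          *\<^sub>R ((LINT y|lborel. (exp (\<theta> * r y) * v y) *\<^sub>R ?g y) /\<^sub>R (LINT y|lborel. exp (\<theta> * r y) * v y))"
      if "0 \<le> \<theta>" "\<theta> \<le> l" for \<theta>
    proof -
      have "score_cov \<alpha> \<sigma> t (w \<theta>) r xt =
        (LINT y|lborel. (forward_kernel \<alpha> \<sigma> t xt y * w \<theta> y * r y) *\<^sub>R ?g y)
          /\<^sub>R (LINT y|lborel. forward_kernel \<alpha> \<sigma> t xt y * w \<theta> y)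
        - ((LINT y|lborel. forward_kernel \<alpha> \<sigma> t xt y * w \<theta> y * r y)
            / (LINT y|lborel. forward_kernel \<alpha> \<sigma> t xt y * w \<theta> y))
          *\<^sub>R ((LINT y|lborel. (forward_kernel \<alpha> \<sigma> t xt y * w \<theta> y) *\<^sub>R ?g y)
            /\<^sub>R (LINT y|lborel. forward_kernel \<alpha> \<sigma> t xt y * w \<theta> y))"
        using w(2)[OF that] by (intro score_cov_eq \<sigma>) auto
      then show ?thesis
        unfolding q_w .
    qed
    have "r \<in> borel_measurable lborel" "?g \<in> borel_measurable lborel"
      by simp_all
    then obtain K where K: "\<And>\<theta> h. 0 \<le> \<theta> \<Longrightarrow> 0 \<le> h \<Longrightarrow> \<theta> + h \<le> l \<Longrightarrow>
      norm ((LINT y|lborel. (exp ((\<theta> + h) * r y) * v y) *\<^sub>R ?g y)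
          /\<^sub>R (LINT y|lborel. exp ((\<theta> + h) * r y) * v y)
       - ((LINT y|lborel. (exp (\<theta> * r y) * v y) *\<^sub>R ?g y) /\<^sub>R (LINT y|lborel. exp (\<theta> * r y) * v y)
        + h *\<^sub>R ((LINT y|lborel. (exp (\<theta> * r y) * v y * r y) *\<^sub>R ?g y) /\<^sub>R (LINT y|lborel. exp (\<theta> * r y) * v y)
        - ((LINT y|lborel. exp (\<theta> * r y) * v y * r y) / (LINT y|lborel. exp (\<theta> * r y) * v y))
          *\<^sub>R ((LINT y|lborel. (exp (\<theta> * r y) * v y) *\<^sub>R ?g y) /\<^sub>R (LINT y|lborel. exp (\<theta> * r y) * v y)))))
        \<le> K * h\<^sup>2"
      using exp_tilt_mean_expansion[OF v_meas _ _ v r(1) W l v_pos] by blast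
    show ?thesis
    proof (rule that)
      fix \<theta> h :: real
      assume *: "0 \<le> \<theta>" "0 < h" "\<theta> + h \<le> l"
      show "norm (score \<alpha> \<sigma> t (w (\<theta> + h)) xt
          - (score \<alpha> \<sigma> t (w \<theta>) xt + h *\<^sub>R score_cov \<alpha> \<sigma> t (w \<theta>) r xt)) \<le> K * h\<^sup>2"
        using K[of \<theta> h] * by (simp only: score cov)
    qed
  qed
qed

section \<open>The expansion along the levels k / N\<close>

text \<open>Since \<open>gradient\<close> is unspecified where differentiability fails,
  differentiability of the log-densities is part of the claim. The order symbol is a bound with
  \<open>K\<close> chosen after \<open>xt\<close> and \<open>t\<close> but before \<open>N\<close>
  and \<open>k\<close>, hence uniform over the levels.\<close>

theorem corollary3p2:
  fixes \<alpha> \<sigma> :: "real \<Rightarrow> real"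
    and pb r :: "real ^ 'n \<Rightarrow> real"
    and lam :: real
  assumes "antimono_on {0..1} \<alpha>" and "mono_on {0..1} \<sigma>"
    and "\<alpha> 0 = 1" "\<sigma> 0 = 0" "\<alpha> 1 = 0" "\<sigma> 1 = 1"
    and "\<And>t. t \<in> {0<..1} \<Longrightarrow> 0 < \<sigma> t"
    and "prob_density pb"
    and "0 < lam"
    and "r \<in> borel_measurable borel"
    and "\<And>x. 0 < r x"
    and "\<exists>C>0. \<forall>x. \<bar>r x\<bar> \<le> C * (1 + norm x)"
    and "integrable lborel (\<lambda>x. exp (lam * r x) * pb x)"
  shows "\<forall>xt :: real ^ 'n. \<forall>t\<in>{0<..1}.
    (\<forall>N\<ge>1. \<forall>k\<le>N.
       (\<lambda>x. ln (noised_density \<alpha> \<sigma> t (tilted_density pb lam r N k) x)) differentiable (at xt)) \<and>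
    (\<exists>K. \<forall>\<^sub>F N in sequentially. \<forall>k\<in>{1..N}.
       norm (score \<alpha> \<sigma> t (tilted_density pb lam r N k) xt
             - (score \<alpha> \<sigma> t (tilted_density pb lam r N (k - 1)) xt
                + (lam / real N) *\<^sub>R score_cov \<alpha> \<sigma> t (tilted_density pb lam r N (k - 1)) r xt))
       \<le> K / (real N)\<^sup>2)"
proof (intro allI ballI)
  fix xt :: "real ^ 'n" and t :: real
  assume "t \<in> {0<..1}"
  then have \<sigma>: "0 < \<sigma> t" by (rule assms(7))
  have pb: "integrable lborel pb" "\<And>x. 0 \<le> pb x" "integral\<^sup>L lborel pb = 1"
    using assms(8) by (auto simp: prob_density_def has_bochner_integral_iff)
  have pb_meas: "pb \<in> borel_measurable borel"
    using pb(1) by (simp add: borel_measurable_integrable flip: measurable_lborel1)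
  have r: "0 \<le> r x" for x
    using assms(11) by (rule less_imp_le)
  obtain C where C: "\<And>x. r x \<le> C * (1 + norm x)"
    using assms(12) by (metis abs_le_D1)
  define w where "w \<theta> = (\<lambda>x. exp (\<theta> * r x) * pb x)" for \<theta>
  define Z where "Z \<theta> = integral\<^sup>L lborel (w \<theta>)" for \<theta>
  \<comment> \<open>Level \<open>k\<close> of \<open>N\<close> is the tilt at \<theta> = (k / N)
    lam, so a single family \<open>w\<close> serves all pairs of \<open>N\<close> and
    \<open>k\<close>.\<close>
  have tilted: "tilted_density pb lam r N k = (\<lambda>x. w (real k / real N * lam) x / Z (real k / real N * lam))" for N k
    by (rule ext) (simp add: tilted_density_def w_def Z_def)
  have w: "integrable lborel (w \<theta>)" "\<And>x. 0 \<le> w \<theta> x" "0 < Z \<theta>" if "0 \<le> \<theta>" "\<theta> \<le> lam" for \<theta>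
  proof -
    show *: "integrable lborel (w \<theta>)"
      unfolding w_def using integrable_exp_tilt(1)[OF pb_meas assms(10) pb(2) r assms(13) that(2)] .
    show "0 \<le> w \<theta> x" for x
      using pb(2) by (simp add: w_def)
    have "integral\<^sup>L lborel pb \<le> Z \<theta>"
      unfolding Z_def
    proof (rule integral_mono[OF pb(1) *])
      show "pb x \<le> w \<theta> x" for x
        unfolding w_def using mult_right_mono[of 1 "exp (\<theta> * r x)" "pb x"] pb(2)[of x] r[of x] that by simp
    qed
    then show "0 < Z \<theta>"
      using pb(3) by simp
  qed
  have range: "0 \<le> real k / real N * lam" "real k / real N * lam \<le> lam" if "1 \<le> N" "k \<le> N" for k N
  proof -
    have "real k / real N \<le> 1"
      using that by simp
    then show "real k / real N * lam \<le> lam"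
      using mult_right_mono[of "real k / real N" 1 lam] assms(9) by simp
  qed (use assms(9) in simp)
  have diff: "(\<lambda>x. ln (noised_density \<alpha> \<sigma> t (tilted_density pb lam r N k) x)) differentiable (at xt)"
    if "1 \<le> N" "k \<le> N" for N k
    unfolding tilted
  proof (rule differentiable_ln_noised_density[where \<sigma> = \<sigma> and t = t, OF \<sigma>])
    note W = w[OF range[OF that]]
    show "integrable lborel (\<lambda>x. w (real k / real N * lam) x / Z (real k / real N * lam))"
      using W(1) by simp
    show "0 \<le> w (real k / real N * lam) x / Z (real k / real N * lam)" for x
      using W(2,3) by (simp add: less_imp_le)
    show "(LINT x|lborel. w (real k / real N * lam) x / Z (real k / real N * lam)) \<noteq> 0"
      using W(3) by (simp add: Z_def)
  qed
  have score: "score \<alpha> \<sigma> t (tilted_density pb lam r N k) xt = score \<alpha> \<sigma> t (w (real k / real N * lam)) xt"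
    if "1 \<le> N" "k \<le> N" for N k
    unfolding tilted
  proof (rule score_divide[where \<sigma> = \<sigma> and t = t, OF \<sigma>])
    note W = w[OF range[OF that]]
    show "integrable lborel (w (real k / real N * lam))"
      and "0 \<le> w (real k / real N * lam) x"
      and "0 < Z (real k / real N * lam)" for x
      using W by simp_all
    then show "integral\<^sup>L lborel (w (real k / real N * lam)) \<noteq> 0"
      by (simp add: Z_def)
  qed
  have cov: "score_cov \<alpha> \<sigma> t (tilted_density pb lam r N k) r xt
      = score_cov \<alpha> \<sigma> t (w (real k / real N * lam)) r xt" if "1 \<le> N" "k \<le> N" for N k
    unfolding tilted using w(3)[OF range[OF that]] by (intro score_cov_divide) simp
  have nz: "integral\<^sup>L lborel pb \<noteq> 0"
    using pb(3) by simp
  obtain K where K: "\<And>\<theta> h. 0 \<le> \<theta> \<Longrightarrow> 0 < h \<Longrightarrow> \<theta> + h \<le> lam \<Longrightarrow>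
    norm (score \<alpha> \<sigma> t (w (\<theta> + h)) xt
      - (score \<alpha> \<sigma> t (w \<theta>) xt + h *\<^sub>R score_cov \<alpha> \<sigma> t (w \<theta>) r xt)) \<le> K * h\<^sup>2"
    by (rule score_tilt_expansion[where \<alpha> = \<alpha> and \<sigma> = \<sigma> and t = t and xt = xt,
        OF \<sigma> less_imp_le[OF assms(9)] assms(10) pb(1,2) nz r C assms(13), folded w_def]) (rule that)
  have "norm (score \<alpha> \<sigma> t (tilted_density pb lam r N k) xt
      - (score \<alpha> \<sigma> t (tilted_density pb lam r N (k - 1)) xt
        + (lam / real N) *\<^sub>R score_cov \<alpha> \<sigma> t (tilted_density pb lam r N (k - 1)) r xt))
      \<le> K * lam\<^sup>2 / (real N)\<^sup>2" if "1 \<le> N" "k \<in> {1..N}" for N k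
  proof -
    \<comment> \<open>Consecutive levels differ by the step h = lam / N. As \<open>k\<close> is at
      least 1, the natural-number subtraction \<open>k - 1\<close> is a true one.\<close>
    have k: "k \<le> N" "k - 1 \<le> N" and step: "real (k - 1) / real N * lam + lam / real N = real k / real N * lam"
      using that by (auto simp: of_nat_diff field_simps)
    have "0 < lam / real N"
      using that assms(9) by simp
    from K[OF range(1)[OF that(1) k(2)] this] show ?thesis
      unfolding step score[OF that(1) k(1)] score[OF that(1) k(2)] cov[OF that(1) k(2)]
      using range(2)[OF that(1) k(1)] by (simp add: power_divide)
  qed
  then have "\<exists>K. \<forall>\<^sub>F N in sequentially. \<forall>k\<in>{1..N}.
       norm (score \<alpha> \<sigma> t (tilted_density pb lam r N k) xt
             - (score \<alpha> \<sigma> t (tilted_density pb lam r N (k - 1)) xt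
                + (lam / real N) *\<^sub>R score_cov \<alpha> \<sigma> t (tilted_density pb lam r N (k - 1)) r xt))
       \<le> K / (real N)\<^sup>2"
    \<comment> \<open>The squared step is lam^2 / N^2, which gives the factor
      \<open>lam\<^sup>2\<close>; the bound already holds from N = 1 on.\<close>
    by (intro exI[of _ "K * lam\<^sup>2"] eventually_sequentiallyI[of 1]) blast
  with diff show "(\<forall>N\<ge>1. \<forall>k\<le>N.
       (\<lambda>x. ln (noised_density \<alpha> \<sigma> t (tilted_density pb lam r N k) x)) differentiable (at xt)) \<and>
    (\<exists>K. \<forall>\<^sub>F N in sequentially. \<forall>k\<in>{1..N}.
       norm (score \<alpha> \<sigma> t (tilted_density pb lam r N k) xt
             - (score \<alpha> \<sigma> t (tilted_density pb lam r N (k - 1)) xt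
                + (lam / real N) *\<^sub>R score_cov \<alpha> \<sigma> t (tilted_density pb lam r N (k - 1)) r xt))
       \<le> K / (real N)\<^sup>2)"
    by blast
qed

end
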